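(* Let $\mu$ be a nontrivial probability measure on $\partial\mathbb{D}$ with CMV matrix $\mathcal{C}$, and let $G$ be a real-valued function in $L^\infty(\partial\mathbb{D},d\mu)$. For $t\ge0$ write the bounded invertible operator $\exp(\tfrac12 tG(\mathcal{C}))$ as $Q_tR_t$ by the $QR$ decomposition, and set $\mathcal{C}_t=Q_t^{-1}\mathcal{C}Q_t$. Then $\mathcal{C}_t$ is the CMV matrix of the probability measure $d\mu_t(\theta)=e^{tG(\theta)}d\mu(\theta)/\int e^{tG(\theta)}d\mu(\theta)$.
   Context: Work on $\mathcal{H}=\ell^2(\{0,1,2,\dots\})$ with canonical basis $\{\delta_n\}$. $QR$ decomposition: every bounded invertible operator $A$ on $\mathcal{H}$ can be written uniquely as $A=QR$ with $Q$ unitary and $R$ bounded, upper triangular ($R_{rs}=0$ for $r>s$) with $R_{rr}>0$. For Verblunsky coefficients $\alpha=(\alpha_n)_{n\ge0}\in\mathbb{D}^\infty$ let $\rho_n=(1-|\alpha_n|^2)^{1/2}$ and $\Theta(\alpha_n)=\begin{pmatrix}\bar\alpha_n&\rho_n\\\rho_n&-\alpha_n\end{pmatrix}$; the CMV matrix is $\mathcal{C}(\alpha)=\mathcal{L}\mathcal{M}$ with $\mathcal{L}=\Theta(\alpha_0)\oplus\Theta(\alpha_2)\oplus\Theta(\alpha_4)\oplus\cdots$ and $\mathcal{M}=\mathbf{1}_{1\times1}\oplus\Theta(\alpha_1)\oplus\Theta(\alpha_3)\oplus\cdots$. The CMV matrix of a nontrivial probability measure $\nu$ on $\partial\mathbb{D}$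 is $\mathcal{C}(\alpha(\nu))$ where $\alpha_n(\nu)$ are its Verblunsky coefficients (defined by $\Phi_{n+1}(z)=z\Phi_n(z)-\bar\alpha_n z^n\overline{\Phi_n(1/\bar z)}$ for the monic orthogonal polynomials $\Phi_n$); it is unitary and the spectral measure of the pair $(\mathcal{C}(\alpha(\nu)),\delta_0)$ is $\nu$. $G(\mathcal{C})$ is defined by the functional calculus. *)

theory Defs
  imports "HOL-Analysis.Analysis" "HOL-Probability.Probability"
    "HOL-Computational_Algebra.Polynomial"
begin

type_synonym seq = "nat \<Rightarrow> complex"

definition l2 :: "seq set" where
  "l2 = {x. summable (\<lambda>n. (cmod (x n))\<^sup>2)}"

definition l2_inner :: "seq \<Rightarrow> seq \<Rightarrow> complex" where
  "l2_inner x y = (\<Sum>n. cnj (x n) * y n)"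

definition l2_norm :: "seq \<Rightarrow> real" where
  "l2_norm x = sqrt (\<Sum>n. (cmod (x n))\<^sup>2)"

definition delta :: "nat \<Rightarrow> seq" where
  "delta s = (\<lambda>n. if n = s then 1 else 0)"

text \<open>A bounded (linear) operator on l^2, represented by its action on l^2
  (values outside l^2 are irrelevant; equalities of operators are always
  stated on l^2).\<close>
definition bounded_op :: "(seq \<Rightarrow> seq) \<Rightarrow> bool" where
  "bounded_op T \<longleftrightarrow> T ` l2 \<subseteq> l2 \<and>
     (\<forall>x\<in>l2. \<forall>y\<in>l2. T (\<lambda>n. x n + y n) = (\<lambda>n. T x n + T y n)) \<and>
     (\<forall>x\<in>l2. \<forall>c. T (\<lambda>n. c * x n) = (\<lambda>n. c * T x n)) \<and>
     (\<exists>K. \<forall>x\<in>l2. l2_norm (T x) \<le> K * l2_norm x)"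

definition unitary_op :: "(seq \<Rightarrow> seq) \<Rightarrow> bool" where
  "unitary_op U \<longleftrightarrow> bounded_op U \<and> bij_betw U l2 l2 \<and>
     (\<forall>x\<in>l2. \<forall>y\<in>l2. l2_inner (U x) (U y) = l2_inner x y)"

definition op_entry :: "(seq \<Rightarrow> seq) \<Rightarrow> nat \<Rightarrow> nat \<Rightarrow> complex" where
  "op_entry T r s = T (delta s) r"

definition upper_tri_pos :: "(seq \<Rightarrow> seq) \<Rightarrow> bool" where
  "upper_tri_pos R \<longleftrightarrow> bounded_op R \<and>
     (\<forall>r s. s < r \<longrightarrow> op_entry R r s = 0) \<and>
     (\<forall>r. op_entry R r r \<in> \<real> \<and> Re (op_entry R r r) > 0)"

definition mat_op :: "(nat \<Rightarrow> nat \<Rightarrow> complex) \<Rightarrow> seq \<Rightarrow> seq" where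
  "mat_op A x = (\<lambda>r. \<Sum>s. A r s * x s)"

text \<open>Operator exponential exp(A) = sum_n A^n / n!, evaluated coordinatewise
  (for bounded A the series converges in norm, hence coordinatewise).\<close>
definition op_exp :: "(seq \<Rightarrow> seq) \<Rightarrow> seq \<Rightarrow> seq" where
  "op_exp A x = (\<lambda>k. \<Sum>n. (A ^^ n) x k / of_nat (fact n))"

definition circle_borel :: "complex measure" where
  "circle_borel = restrict_space borel (sphere 0 1)"

definition spectral_measure :: "(seq \<Rightarrow> seq) \<Rightarrow> seq \<Rightarrow> complex measure \<Rightarrow> bool" where
  "spectral_measure U x \<nu> \<longleftrightarrow> sets \<nu> = sets circle_borel \<and> finite_measure \<nu> \<and>
     (\<forall>n::nat. (\<integral>z. z ^ n \<partial>\<nu>) = l2_inner x ((U ^^ n) x))"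

text \<open>Borel functional calculus of a unitary U: f(U) is the bounded operator
  whose quadratic form is x \<mapsto> integral of f against the spectral measure of (U,x)
  (normalised to 0 off l^2 so that it is uniquely determined).\<close>
definition fun_calc :: "(seq \<Rightarrow> seq) \<Rightarrow> (complex \<Rightarrow> complex) \<Rightarrow> seq \<Rightarrow> seq" where
  "fun_calc U f = (THE T. bounded_op T \<and> (\<forall>x. x \<notin> l2 \<longrightarrow> T x = (\<lambda>_. 0)) \<and>
     (\<forall>x\<in>l2. \<forall>\<nu>. spectral_measure U x \<nu> \<longrightarrow> l2_inner x (T x) = (\<integral>z. f z \<partial>\<nu>)))"

definition nontrivial_meas :: "complex measure \<Rightarrow> bool" where
  "nontrivial_meas \<mu> \<longleftrightarrow> \<not> (\<exists>F. finite F \<and> (AE z in \<mu>. z \<in> F))"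

definition monic_OP :: "complex measure \<Rightarrow> nat \<Rightarrow> complex poly" where
  "monic_OP \<mu> n = (THE p. degree p = n \<and> lead_coeff p = 1 \<and>
     (\<forall>k<n. (\<integral>z. poly p z * cnj (z ^ k) \<partial>\<mu>) = 0))"

text \<open>Szego recursion Phi_{n+1}(z) = z Phi_n(z) - conj(alpha_n) Phi_n^*(z),
  Phi_n^*(z) = z^n conj(Phi_n(1/conj z)).\<close>
definition verblunsky :: "complex measure \<Rightarrow> nat \<Rightarrow> complex" where
  "verblunsky \<mu> n = (THE a. \<forall>z. z \<noteq> 0 \<longrightarrow>
     poly (monic_OP \<mu> (Suc n)) z =
       z * poly (monic_OP \<mu> n) z - cnj a * (z ^ n * cnj (poly (monic_OP \<mu> n) (1 / cnj z))))"

definition rho :: "complex \<Rightarrow> complex" where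
  "rho a = complex_of_real (sqrt (1 - (cmod a)\<^sup>2))"

definition Theta :: "complex \<Rightarrow> nat \<Rightarrow> nat \<Rightarrow> complex" where
  "Theta a i j = (if i = 0 \<and> j = 0 then cnj a else if i = 1 \<and> j = 1 then - a else rho a)"

text \<open>L = Theta(alpha_0) (+) Theta(alpha_2) (+) ...\<close>
definition CMV_L :: "(nat \<Rightarrow> complex) \<Rightarrow> nat \<Rightarrow> nat \<Rightarrow> complex" where
  "CMV_L \<alpha> r s = (if r div 2 = s div 2 then Theta (\<alpha> (2 * (r div 2))) (r mod 2) (s mod 2) else 0)"

text \<open>M = 1 (+) Theta(alpha_1) (+) Theta(alpha_3) (+) ...\<close>
definition CMV_M :: "(nat \<Rightarrow> complex) \<Rightarrow> nat \<Rightarrow> nat \<Rightarrow> complex" where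
  "CMV_M \<alpha> r s = (if r = 0 \<and> s = 0 then 1
     else if r \<ge> 1 \<and> s \<ge> 1 \<and> (r + 1) div 2 = (s + 1) div 2
       then Theta (\<alpha> (2 * ((r + 1) div 2) - 1)) ((r + 1) mod 2) ((s + 1) mod 2)
     else 0)"

definition CMV_op :: "(nat \<Rightarrow> complex) \<Rightarrow> seq \<Rightarrow> seq" where
  "CMV_op \<alpha> = mat_op (CMV_L \<alpha>) \<circ> mat_op (CMV_M \<alpha>)"

definition CMV_of :: "complex measure \<Rightarrow> seq \<Rightarrow> seq" where
  "CMV_of \<mu> = CMV_op (verblunsky \<mu>)"

end

theory Submission
  imports Defs
begin

text \<open>
  Let \<open>U\<close> be the unitary from \<open>L\<^sup>2(\<mu>)\<close> to \<open>\<ell>\<^sup>2\<close> that maps the CMV basis \<open>X j\<close> to \<open>\<delta>\<^sub>j\<close>. It turns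
  multiplication by \<open>z\<close> into the CMV matrix, hence multiplication by \<open>exp (t G / 2)\<close> into
  \<open>exp (t G(C) / 2)\<close>. With \<open>w = exp (t G / 2) / sqrt Z\<close>, where \<open>Z\<close> is the normalising constant,
  \<open>f \<mapsto> w f\<close> is isometric from \<open>L\<^sup>2(\<mu>\<^sub>t)\<close> to \<open>L\<^sup>2(\<mu>)\<close> and commutes with multiplication by \<open>z\<close>.
  The factorisation \<open>exp (t G(C) / 2) = Q R\<close> says that the vectors \<open>Q \<delta>\<^sub>j\<close> arise by Gram--Schmidt
  from the \<open>U (w X j)\<close>. The CMV basis \<open>X' j\<close> of \<open>\<mu>\<^sub>t\<close> arises by Gram--Schmidt in \<open>L\<^sup>2(\<mu>\<^sub>t)\<close> from the
  \<open>X j\<close>, because both bases orthonormalise the same sequence of powers of \<open>z\<close>. Therefore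
  \<open>Q \<delta>\<^sub>j = U (w X' j)\<close>, and conjugation by \<open>Q\<close> gives the CMV matrix of \<open>\<mu>\<^sub>t\<close>.
\<close>

subsection \<open>Finite measures on the circle and their moments\<close>

text \<open>\<open>fun_calc\<close> is a definite description that constrains an operator only
  through its quadratic form, tested against spectral measures, and a spectral measure is specified
  by its nonnegative moments. Identifying G(C) therefore rests on three facts: such moments
  determine a finite measure on the circle, every vector of \<open>l2\<close> has a spectral
  measure, and a bounded operator is fixed by its quadratic form. The first fact also gives
  completeness of the CMV basis: the factors L and M show that its orthogonal complement is stable
  under multiplication by z and 1/z, and since \<open>X 0\<close> is 1, all moments of a function in
  the complement vanish. Elements of L^2 are plain functions compared almost everywhere, so a
  Riesz-Fischer argument is needed to return from sequences to functions. Gram-Schmidt determines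
  vectors only up to phases; positivity of both triangular diagonals removes that freedom.
  Throughout, \<open>cnj z\<close> stands for 1/z on the circle.\<close>

lemma circle_power_mult_cnj: "z \<in> sphere 0 1 \<Longrightarrow> z ^ n * cnj z ^ n = 1"
proof -
  assume "z \<in> sphere 0 1"
  then have "z * cnj z = 1"
    by (simp add: complex_norm_square[symmetric])
  then show ?thesis
    by (simp flip: power_mult_distrib)
qed

text \<open>On the circle Re z = (z + 1/z)/2 and Im z = (z - 1/z)/(2i), so real polynomials become
  Laurent polynomials. Writing them over one power of \<open>cnj z\<close> keeps the class closed
  under sums and products.\<close>

lemma real_polynomial_function_on_circle:
  fixes p :: "complex \<Rightarrow> real"
  assumes "real_polynomial_function p"
  shows "\<exists>q N. \<forall>z\<in>sphere 0 1. complex_of_real (p z) = poly q z * cnj z ^ N"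
  using assms
proof induction
  case (linear f)
  interpret bounded_linear f by fact
  have "complex_of_real (f z)
      = poly [:f 1 / 2 + \<i> * f \<i> / 2, 0, f 1 / 2 - \<i> * f \<i> / 2:] z * cnj z ^ 1"
    if "z \<in> sphere 0 1" for z
  proof -
    have "z = Re z *\<^sub>R 1 + Im z *\<^sub>R \<i>"
      by (simp add: complex_eq_iff)
    then have "f z = Re z * f 1 + Im z * f \<i>"
      by (metis add scaleR real_scaleR_def)
    moreover have "poly [:a, 0, b:] z * cnj z = a * cnj z + b * z" for a b
    proof -
      have "poly [:a, 0, b:] z * cnj z = a * cnj z + b * z * (z ^ 1 * cnj z ^ 1)"
        by (simp add: algebra_simps)
      then show ?thesis
        by (simp only: circle_power_mult_cnj[OF that] mult_1_right)
    qed
    ultimately show ?thesis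
      by (simp only: power_one_right) (simp add: complex_eq_iff field_simps)
  qed
  then show ?case by blast
next
  case (const c)
  have "\<forall>z\<in>sphere 0 1. complex_of_real c = poly [:complex_of_real c:] z * cnj z ^ 0"
    by simp
  then show ?case by blast
next
  case (add f g)
  then obtain p M q N where
    p: "\<And>z. z \<in> sphere 0 1 \<Longrightarrow> complex_of_real (f z) = poly p z * cnj z ^ M" and
    q: "\<And>z. z \<in> sphere 0 1 \<Longrightarrow> complex_of_real (g z) = poly q z * cnj z ^ N"
    by metis
  have "complex_of_real (f z + g z) = poly (p * monom 1 N + q * monom 1 M) z * cnj z ^ (M + N)"
    if "z \<in> sphere 0 1" for z
  proof -
    note 1 = circle_power_mult_cnj[OF that]
    have "poly (p * monom 1 N + q * monom 1 M) z * cnj z ^ (M + N)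
        = poly p z * cnj z ^ M * (z ^ N * cnj z ^ N) + poly q z * cnj z ^ N * (z ^ M * cnj z ^ M)"
      by (simp add: poly_monom power_add algebra_simps)
    then show ?thesis
      using p[OF that] q[OF that] by (simp add: 1)
  qed
  then show ?case by blast
next
  case (mult f g)
  then obtain p M q N where
    p: "\<And>z. z \<in> sphere 0 1 \<Longrightarrow> complex_of_real (f z) = poly p z * cnj z ^ M" and
    q: "\<And>z. z \<in> sphere 0 1 \<Longrightarrow> complex_of_real (g z) = poly q z * cnj z ^ N"
    by metis
  have "complex_of_real (f z * g z) = poly (p * q) z * cnj z ^ (M + N)"
    if "z \<in> sphere 0 1" for z
    using p[OF that] q[OF that] by (simp add: power_add)
  then show ?case by blast
qed

lemma space_circle_borel: "sets M = sets circle_borel \<Longrightarrow> space M = sphere 0 1"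
  by (metis circle_borel_def sets_eq_imp_space_eq inf_top.right_neutral space_borel space_restrict_space)

lemma borel_measurable_circle_continuous:
  fixes f :: "complex \<Rightarrow> 'b::topological_space"
  assumes "sets M = sets circle_borel" "continuous_on (sphere 0 1) f"
  shows "f \<in> borel_measurable M"
proof -
  have "f \<in> borel_measurable circle_borel"
    unfolding circle_borel_def by (rule borel_measurable_continuous_on_restrict) fact
  then show ?thesis
    using assms(1) measurable_cong_sets by blast
qed

lemma integrable_circle_continuous:
  fixes f :: "complex \<Rightarrow> 'b::{banach,second_countable_topology}"
  assumes "finite_measure M" "sets M = sets circle_borel" "continuous_on (sphere 0 1) f"
  shows "integrable M f"
proof -
  have "compact (f ` sphere 0 1)"
    using assms(3) compact_continuous_image compact_sphere by blast
  then obtain B where "\<And>z. z \<in> sphere 0 1 \<Longrightarrow> norm (f z) \<le> B"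
    by (metis bounded_iff compact_imp_bounded imageI)
  then show ?thesis
    using assms borel_measurable_circle_continuous[OF assms(2,3)] space_circle_borel[OF assms(2)]
    by (intro finite_measure.integrable_const_bound[where B = B]) auto
qed

text \<open>On the circle \<open>z ^ n * cnj z ^ k\<close> collapses to a power of z or to the
  conjugate of one, so negative moments are conjugates of nonnegative ones.\<close>

lemma laurent_integral_eq:
  assumes "finite_measure M" "finite_measure N"
    and M: "sets M = sets circle_borel" and N: "sets N = sets circle_borel"
    and moments: "\<And>n::nat. (\<integral>z. z ^ n \<partial>M) = (\<integral>z. z ^ n \<partial>N)"
  shows "(\<integral>z. poly q z * cnj z ^ k \<partial>M) = (\<integral>z. poly q z * cnj z ^ k \<partial>N)"
proof -
  have eq: "z ^ n * cnj z ^ k = (if k \<le> n then z ^ (n - k) else cnj (z ^ (k - n)))"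
    if "z \<in> sphere 0 1" for z :: complex and n
  proof -
    note 1 = circle_power_mult_cnj[OF that]
    show ?thesis
    proof (cases "k \<le> n")
      case True
      then have "z ^ n = z ^ (n - k) * z ^ k" by (simp flip: power_add)
      then show ?thesis using True 1[of k] by (simp add: mult.assoc)
    next
      case False
      then have "cnj z ^ k = cnj z ^ n * cnj z ^ (k - n)" by (simp flip: power_add)
      then show ?thesis using False 1[of n] by (simp flip: mult.assoc)
    qed
  qed
  have mono: "(\<integral>z. z ^ n * cnj z ^ k \<partial>M) = (\<integral>z. z ^ n * cnj z ^ k \<partial>N)" for n
  proof -
    have "(\<integral>z. z ^ n * cnj z ^ k \<partial>L) = (if k \<le> n then \<integral>z. z ^ (n - k) \<partial>L
        else cnj (\<integral>z. z ^ (k - n) \<partial>L))" if "sets L = sets circle_borel" for L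
      using space_circle_borel[OF that] eq
      by (auto simp del: complex_cnj_power simp flip: Bochner_Integration.integral_cnj
          intro!: Bochner_Integration.integral_cong)
    then show ?thesis using moments M N by metis
  qed
  have "(\<integral>z. poly q z * cnj z ^ k \<partial>L) = (\<Sum>i\<le>degree q. coeff q i * (\<integral>z. z ^ i * cnj z ^ k \<partial>L))"
    if "finite_measure L" "sets L = sets circle_borel" for L
  proof -
    have "(\<integral>z. poly q z * cnj z ^ k \<partial>L)
        = (\<integral>z. (\<Sum>i\<le>degree q. coeff q i * (z ^ i * cnj z ^ k)) \<partial>L)"
      by (simp add: poly_altdef sum_distrib_right mult.assoc)
    also have "\<dots> = (\<Sum>i\<le>degree q. \<integral>z. coeff q i * (z ^ i * cnj z ^ k) \<partial>L)"
      by (intro Bochner_Integration.integral_sum integrable_circle_continuous that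
          continuous_intros)
    finally show ?thesis by simp
  qed
  then show ?thesis
    using assms mono by simp
qed

text \<open>Stone-Weierstrass approximates \<open>g\<close> uniformly by real polynomials, whose
  integrals already agree.\<close>

lemma continuous_integral_eq:
  fixes g :: "complex \<Rightarrow> real"
  assumes M: "finite_measure M" "sets M = sets circle_borel"
    and N: "finite_measure N" "sets N = sets circle_borel"
    and moments: "\<And>n::nat. (\<integral>z. z ^ n \<partial>M) = (\<integral>z. z ^ n \<partial>N)"
    and g: "continuous_on (sphere 0 1) g"
  shows "integral\<^sup>L M g = integral\<^sup>L N g"
proof (rule ccontr)
  assume neq: "integral\<^sup>L M g \<noteq> integral\<^sup>L N g"
  \<comment> \<open>The summand 1 keeps \<open>m\<close> positive and leaves room: the approximation
    error is at most \<open>e * (m - 1)\<close>, while the assumed gap is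
    \<open>e * m\<close>.\<close>
  define m where "m = measure M (space M) + measure N (space N) + 1"
  have m: "m > 0" by (simp add: m_def add_nonneg_pos)
  define e where "e = \<bar>integral\<^sup>L M g - integral\<^sup>L N g\<bar> / m"
  have e: "e > 0" using neq m by (simp add: e_def)
  obtain p where p: "real_polynomial_function p"
    and close: "\<And>z. z \<in> sphere 0 1 \<Longrightarrow> \<bar>g z - p z\<bar> < e"
    using Stone_Weierstrass_real_polynomial_function[OF compact_sphere g e] by metis
  obtain q k where q: "\<And>z. z \<in> sphere 0 1 \<Longrightarrow> complex_of_real (p z) = poly q z * cnj z ^ k"
    using real_polynomial_function_on_circle[OF p] by metis
  have cp: "continuous_on (sphere 0 1) p"
    by (meson continuous_on_polymonial_function p real_polynomial_function_eq)
  have "complex_of_real (integral\<^sup>L L p) = (\<integral>z. poly q z * cnj z ^ k \<partial>L)"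
    if "sets L = sets circle_borel" for L
    using space_circle_borel[OF that] q
    by (auto simp flip: integral_complex_of_real intro!: Bochner_Integration.integral_cong)
  then have "complex_of_real (integral\<^sup>L M p) = complex_of_real (integral\<^sup>L N p)"
    using laurent_integral_eq[OF M(1) N(1) M(2) N(2) moments] M N by simp
  then have pp: "integral\<^sup>L M p = integral\<^sup>L N p"
    using of_real_eq_iff by blast
  have err: "\<bar>integral\<^sup>L L g - integral\<^sup>L L p\<bar> \<le> e * measure L (space L)"
    if L: "finite_measure L" "sets L = sets circle_borel" for L
  proof -
    interpret finite_measure L by fact
    have i: "integrable L g" "integrable L p"
      using L g cp integrable_circle_continuous by blast+
    have "\<bar>integral\<^sup>L L g - integral\<^sup>L L p\<bar> = \<bar>\<integral>z. g z - p z \<partial>L\<bar>"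
      using i by simp
    also have "\<dots> \<le> (\<integral>z. \<bar>g z - p z\<bar> \<partial>L)"
      by (rule integral_abs_bound)
    also have "\<dots> \<le> (\<integral>z. e \<partial>L)"
      using i close space_circle_borel[OF L(2)]
      by (intro integral_mono) (auto intro: less_imp_le)
    finally show ?thesis by (simp add: mult.commute)
  qed
  have "\<bar>integral\<^sup>L M g - integral\<^sup>L N g\<bar> \<le> e * (m - 1)"
    using err[OF M] err[OF N] pp by (simp add: m_def algebra_simps)
  also have "\<dots> < e * m" using e by simp
  finally show False using m by (simp add: e_def)
qed

text \<open>Continuous cutoffs bounded by 1 converge pointwise to the indicator of a closed set.
  Nonemptiness matters: \<open>infdist\<close> to the empty set is 0, and the cutoffs would all be
  1.\<close>

lemma closed_measure_eq:
  assumes M: "finite_measure M" "sets M = sets circle_borel"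
    and N: "finite_measure N" "sets N = sets circle_borel"
    and moments: "\<And>n::nat. (\<integral>z. z ^ n \<partial>M) = (\<integral>z. z ^ n \<partial>N)"
    and A: "closed A" "A \<noteq> {}" "A \<subseteq> sphere 0 1"
  shows "measure M A = measure N A"
proof -
  define g where "g n z = max 0 (1 - real n * infdist z A)" for n z
  have g: "continuous_on (sphere 0 1) (g n)" for n
    unfolding g_def by (intro continuous_intros)
  have lim: "(\<lambda>n. g n z) \<longlonglongrightarrow> indicator A z" for z
  proof (cases "z \<in> A")
    case True
    then show ?thesis by (simp add: g_def)
  next
    case False
    then have "infdist z A > 0"
      using A infdist_pos_not_in_closed by blast
    then obtain k where k: "real k * infdist z A > 1"
      using reals_Archimedean3 by blast
    have "g n z = 0" if "n \<ge> k" for n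
    proof -
      have "real k * infdist z A \<le> real n * infdist z A"
        using that by (intro mult_right_mono) (auto simp: infdist_nonneg)
      then show ?thesis using k by (simp add: g_def)
    qed
    then have "\<forall>\<^sub>F n in sequentially. g n z = 0"
      using eventually_sequentially by blast
    then show ?thesis
      using False by (simp add: tendsto_eventually)
  qed
  have conv: "(\<lambda>n. integral\<^sup>L L (g n)) \<longlonglongrightarrow> measure L A"
    if L: "finite_measure L" "sets L = sets circle_borel" for L
  proof -
    interpret finite_measure L by fact
    have AL: "A \<in> sets L"
    proof -
      have "A = sphere 0 1 \<inter> A" using A by blast
      then show ?thesis
        using A(1) L(2) by (auto simp: circle_borel_def sets_restrict_space)
    qed
    have "(\<lambda>n. integral\<^sup>L L (g n)) \<longlonglongrightarrow> integral\<^sup>L L (indicator A)"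
    proof (rule integral_dominated_convergence[where w = "\<lambda>_. 1"])
      show "\<And>n. AE x in L. norm (g n x) \<le> 1"
        by (simp add: g_def infdist_nonneg)
    qed (use AL lim borel_measurable_circle_continuous[OF L(2) g] in auto)
    then show ?thesis
      using AL sets.sets_into_space[OF AL] by (simp add: Int_absorb1 Int_absorb2)
  qed
  show ?thesis
    using conv[OF M] conv[OF N] continuous_integral_eq[OF M N moments g] LIMSEQ_unique by fastforce
qed

text \<open>Closed subsets of the circle form an intersection-stable generator of its Borel
  sets.\<close>

lemma moments_determine_measure:
  assumes M: "finite_measure M" "sets M = sets circle_borel"
    and N: "finite_measure N" "sets N = sets circle_borel"
    and moments: "\<And>n::nat. (\<integral>z. z ^ n \<partial>M) = (\<integral>z. z ^ n \<partial>N)"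
  shows "M = N"
proof (rule measure_eqI_generator_eq[where E = "{A. closed A \<and> A \<subseteq> sphere 0 1}"
      and \<Omega> = "sphere 0 1" and A = "\<lambda>_. sphere 0 1"])
  let ?E = "{A :: complex set. closed A \<and> A \<subseteq> sphere 0 1}"
  interpret M: finite_measure M by fact
  interpret N: finite_measure N by fact
  show "Int_stable ?E" by (auto simp: Int_stable_def)
  show "emeasure M A = emeasure N A" if "A \<in> ?E" for A
    using closed_measure_eq[OF M N moments, of A] that
    by (cases "A = {}") (auto simp: M.emeasure_eq_measure N.emeasure_eq_measure)
  have "sets circle_borel = sigma_sets (sphere 0 1) ?E"
  proof -
    have b: "sets (borel :: complex measure) = sigma_sets UNIV (Collect closed)"
      by (subst borel_eq_closed) simp
    have sph: "(sphere 0 1 :: complex set) \<in> sigma_sets UNIV (Collect closed)"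
      by (auto intro!: sigma_sets.Basic)
    have "sets circle_borel = sigma_sets (sphere 0 1) ((\<inter>) (sphere 0 1) ` Collect closed)"
      using sigma_sets_Int[OF sph subset_UNIV]
      by (simp add: circle_borel_def sets_restrict_space b)
    also have "(\<inter>) (sphere 0 1) ` Collect closed = ?E"
      by (auto simp: image_iff)
    finally show ?thesis .
  qed
  then show "sets M = sigma_sets (sphere 0 1) ?E" "sets N = sigma_sets (sphere 0 1) ?E"
    using M N by auto
qed (use M finite_measure.emeasure_finite in auto)

subsection \<open>Square-integrable functions and orthonormal bases\<close>

definition sqint :: "'a measure \<Rightarrow> ('a \<Rightarrow> complex) \<Rightarrow> bool" where
  "sqint M f \<longleftrightarrow> f \<in> borel_measurable M \<and> integrable M (\<lambda>x. (cmod (f x))\<^sup>2)"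

text \<open>Conjugate-linear in the first argument, to match \<open>l2_inner\<close>.\<close>

definition ip :: "'a measure \<Rightarrow> ('a \<Rightarrow> complex) \<Rightarrow> ('a \<Rightarrow> complex) \<Rightarrow> complex" where
  "ip M f g = (\<integral>x. cnj (f x) * g x \<partial>M)"

lemma borel_measurable_cnj [measurable (raw)]:
  "f \<in> borel_measurable M \<Longrightarrow> (\<lambda>x. cnj (f x)) \<in> borel_measurable M"
  by (rule borel_measurable_continuous_on[of cnj]) (intro continuous_intros)

lemma sqint_measurable [measurable_dest]: "sqint M f \<Longrightarrow> f \<in> borel_measurable M"
  by (simp add: sqint_def)

lemma sqint_integrable_ip:
  assumes "sqint M f" "sqint M g"
  shows "integrable M (\<lambda>x. cnj (f x) * g x)"
proof (rule Bochner_Integration.integrable_bound)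
  show "integrable M (\<lambda>x. (cmod (f x))\<^sup>2 + (cmod (g x))\<^sup>2)"
    using assms by (simp add: sqint_def)
  show "(\<lambda>x. cnj (f x) * g x) \<in> borel_measurable M"
    using assms by (auto simp: sqint_def)
  have "a * b \<le> a\<^sup>2 + b\<^sup>2" if "a \<ge> 0" "b \<ge> 0" for a b :: real
    using that sum_squares_bound[of a b] zero_le_mult_iff[of a b] by linarith
  then show "AE x in M. norm (cnj (f x) * g x) \<le> norm ((cmod (f x))\<^sup>2 + (cmod (g x))\<^sup>2)"
    by (simp add: norm_mult)
qed

lemma sqint_mult_bounded:
  assumes "sqint M f" and "h \<in> borel_measurable M" and "AE x in M. cmod (h x) \<le> B"
  shows "sqint M (\<lambda>x. h x * f x)"
  unfolding sqint_def
proof (intro conjI)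
  show "integrable M (\<lambda>x. (cmod (h x * f x))\<^sup>2)"
  proof (rule Bochner_Integration.integrable_bound)
    show "integrable M (\<lambda>x. B\<^sup>2 * (cmod (f x))\<^sup>2)"
      using assms by (simp add: sqint_def)
    show "AE x in M. norm ((cmod (h x * f x))\<^sup>2) \<le> norm (B\<^sup>2 * (cmod (f x))\<^sup>2)"
      using assms(3)
    proof eventually_elim
      case (elim x)
      then have "(cmod (h x))\<^sup>2 \<le> B\<^sup>2"
        by (intro power_mono) auto
      then show ?case
        by (simp add: norm_mult power_mult_distrib mult_right_mono)
    qed
  qed (use assms in \<open>auto simp: sqint_def\<close>)
qed (use assms in \<open>auto simp: sqint_def\<close>)

lemma sqint_cmult: "sqint M f \<Longrightarrow> sqint M (\<lambda>x. c * f x)"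
  by (rule sqint_mult_bounded[where B = "cmod c"]) auto

lemma sqint_zero: "sqint M (\<lambda>_. 0)"
  by (simp add: sqint_def)

lemma sqint_add:
  assumes "sqint M f" "sqint M g"
  shows "sqint M (\<lambda>x. f x + g x)"
  unfolding sqint_def
proof (intro conjI)
  show "integrable M (\<lambda>x. (cmod (f x + g x))\<^sup>2)"
  proof (rule Bochner_Integration.integrable_bound)
    show "integrable M (\<lambda>x. 2 * (cmod (f x))\<^sup>2 + 2 * (cmod (g x))\<^sup>2)"
      using assms by (simp add: sqint_def)
    have "(cmod (a + b))\<^sup>2 \<le> 2 * (cmod a)\<^sup>2 + 2 * (cmod b)\<^sup>2" for a b
    proof -
      have "(cmod (a + b))\<^sup>2 \<le> (cmod a + cmod b)\<^sup>2"
        by (intro power_mono norm_triangle_ineq) auto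
      also have "\<dots> \<le> 2 * (cmod a)\<^sup>2 + 2 * (cmod b)\<^sup>2"
        using sum_squares_bound[of "cmod a" "cmod b"] by (simp add: power2_sum)
      finally show ?thesis .
    qed
    then show "AE x in M. norm ((cmod (f x + g x))\<^sup>2)
        \<le> norm (2 * (cmod (f x))\<^sup>2 + 2 * (cmod (g x))\<^sup>2)"
      by simp
  qed (use assms in \<open>auto simp: sqint_def\<close>)
qed (use assms in \<open>auto simp: sqint_def\<close>)

lemma sqint_diff: "sqint M f \<Longrightarrow> sqint M g \<Longrightarrow> sqint M (\<lambda>x. f x - g x)"
  using sqint_add[of M f "\<lambda>x. - 1 * g x"] sqint_cmult[of M g "-1"] by simp

lemma sqint_sum: "(\<And>i. i \<in> I \<Longrightarrow> sqint M (f i)) \<Longrightarrow> sqint M (\<lambda>x. \<Sum>i\<in>I. f i x)"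
  by (induction I rule: infinite_finite_induct) (auto simp: sqint_zero sqint_add)

lemma ip_add_right: "\<lbrakk>sqint M f; sqint M g; sqint M h\<rbrakk> \<Longrightarrow>
    ip M f (\<lambda>x. g x + h x) = ip M f g + ip M f h"
  by (simp add: ip_def distrib_left sqint_integrable_ip)

lemma ip_diff_right: "\<lbrakk>sqint M f; sqint M g; sqint M h\<rbrakk> \<Longrightarrow>
    ip M f (\<lambda>x. g x - h x) = ip M f g - ip M f h"
  by (simp add: ip_def right_diff_distrib sqint_integrable_ip)

lemma ip_diff_left: "\<lbrakk>sqint M f; sqint M g; sqint M h\<rbrakk> \<Longrightarrow>
    ip M (\<lambda>x. f x - g x) h = ip M f h - ip M g h"
  by (simp add: ip_def left_diff_distrib sqint_integrable_ip)

lemma ip_cmult_right: "ip M f (\<lambda>x. c * g x) = c * ip M f g"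
  unfolding ip_def by (subst mult.left_commute) simp

lemma ip_cmult_left: "ip M (\<lambda>x. c * f x) g = cnj c * ip M f g"
  by (simp add: ip_def mult.assoc)

lemma ip_add_left: "\<lbrakk>sqint M f; sqint M g; sqint M h\<rbrakk> \<Longrightarrow>
    ip M (\<lambda>x. f x + g x) h = ip M f h + ip M g h"
  by (simp add: ip_def distrib_right sqint_integrable_ip)

lemma ip_cnj: "cnj (ip M f g) = ip M g f"
  unfolding ip_def by (simp add: mult.commute flip: Bochner_Integration.integral_cnj)

lemma ip_sum_right:
  "sqint M f \<Longrightarrow> (\<And>i. i \<in> I \<Longrightarrow> sqint M (g i)) \<Longrightarrow>
    ip M f (\<lambda>x. \<Sum>i\<in>I. g i x) = (\<Sum>i\<in>I. ip M f (g i))"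
  unfolding ip_def sum_distrib_left
  by (rule Bochner_Integration.integral_sum) (rule sqint_integrable_ip)

lemma ip_cong_AE:
  "\<lbrakk>f \<in> borel_measurable M; g \<in> borel_measurable M; h \<in> borel_measurable M; AE x in M. g x = h x\<rbrakk>
    \<Longrightarrow> ip M f g = ip M f h"
  unfolding ip_def by (intro integral_cong_AE) auto

lemma ip_self: "ip M f f = complex_of_real (\<integral>x. (cmod (f x))\<^sup>2 \<partial>M)"
  unfolding ip_def
  by (simp add: mult.commute complex_norm_square del: of_real_power flip: integral_complex_of_real)

text \<open>The integral of (s|f| - |g|)^2 is a quadratic polynomial in s without negative
  values.\<close>

lemma ip_Cauchy_Schwarz:
  assumes f: "sqint M f" and g: "sqint M g"
  shows "(cmod (ip M f g))\<^sup>2 \<le> (\<integral>x. (cmod (f x))\<^sup>2 \<partial>M) * (\<integral>x. (cmod (g x))\<^sup>2 \<partial>M)"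
proof -
  define F G A where "F = (\<integral>x. (cmod (f x))\<^sup>2 \<partial>M)" and "G = (\<integral>x. (cmod (g x))\<^sup>2 \<partial>M)"
    and "A = (\<integral>x. cmod (f x) * cmod (g x) \<partial>M)"
  have int: "integrable M (\<lambda>x. cmod (f x) * cmod (g x))"
    using integrable_norm[OF sqint_integrable_ip[OF f g]] by (simp add: norm_mult)
  have A: "cmod (ip M f g) \<le> A"
    unfolding ip_def A_def using integral_norm_bound[of M "\<lambda>x. cnj (f x) * g x"]
    by (simp add: norm_mult)
  have quad: "0 \<le> s\<^sup>2 * F - 2 * s * A + G" for s
  proof -
    have "0 \<le> (\<integral>x. (s * cmod (f x) - cmod (g x))\<^sup>2 \<partial>M)"
      by simp
    also have "\<dots> = (\<integral>x. s\<^sup>2 * (cmod (f x))\<^sup>2 - 2 * s * (cmod (f x) * cmod (g x)) + (cmod (g x))\<^sup>2 \<partial>M)"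
      by (simp add: power2_diff power_mult_distrib mult.assoc algebra_simps)
    also have "\<dots> = s\<^sup>2 * F - 2 * s * A + G"
      using f g int by (simp add: F_def G_def A_def sqint_def)
    finally show ?thesis .
  qed
  have "A\<^sup>2 \<le> F * G"
  proof (cases "F = 0")
    case True
    have "A = 0"
    proof (rule ccontr)
      assume "A \<noteq> 0"
      \<comment> \<open>For F = 0 the quadratic is affine in s, and this s gives it the value
        -1.\<close>
      then show False
        using quad[of "(G + 1) / (2 * A)"] True by simp
    qed
    then show ?thesis by (simp add: True)
  next
    case False
    then have "F > 0" by (simp add: F_def less_le)
    then show ?thesis
      using quad[of "A / F"] by (simp add: field_simps power2_eq_square)
  qed
  moreover have "(cmod (ip M f g))\<^sup>2 \<le> A\<^sup>2"
    using A by (intro power_mono) auto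
  ultimately show ?thesis by (simp add: F_def G_def)
qed

lemma ip_tendsto:
  assumes f: "sqint M f" and g: "sqint M g" and h: "\<And>n. sqint M (h n)"
    and lim: "(\<lambda>n. \<integral>x. (cmod (g x - h n x))\<^sup>2 \<partial>M) \<longlonglongrightarrow> 0"
  shows "(\<lambda>n. ip M f (h n)) \<longlonglongrightarrow> ip M f g"
proof -
  have "(\<lambda>n. (cmod (ip M f (\<lambda>x. g x - h n x)))\<^sup>2) \<longlonglongrightarrow> 0"
  proof (rule tendsto_sandwich[OF _ _ tendsto_const])
    show "\<forall>\<^sub>F n in sequentially. (cmod (ip M f (\<lambda>x. g x - h n x)))\<^sup>2
        \<le> (\<integral>x. (cmod (f x))\<^sup>2 \<partial>M) * (\<integral>x. (cmod (g x - h n x))\<^sup>2 \<partial>M)"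
      using ip_Cauchy_Schwarz[OF f sqint_diff[OF g h]] by simp
    show "(\<lambda>n. (\<integral>x. (cmod (f x))\<^sup>2 \<partial>M) * (\<integral>x. (cmod (g x - h n x))\<^sup>2 \<partial>M)) \<longlonglongrightarrow> 0"
      using lim by (rule tendsto_mult_right_zero)
  qed simp
  then have "(\<lambda>n. sqrt ((cmod (ip M f (\<lambda>x. g x - h n x)))\<^sup>2)) \<longlonglongrightarrow> sqrt 0"
    by (rule tendsto_real_sqrt)
  then have "(\<lambda>n. ip M f g - ip M f (h n)) \<longlonglongrightarrow> 0"
    using f g h by (simp add: ip_diff_right tendsto_norm_zero_iff)
  then have "(\<lambda>n. ip M f g - (ip M f g - ip M f (h n))) \<longlonglongrightarrow> ip M f g - 0"
    by (intro tendsto_diff tendsto_const)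
  then show ?thesis by simp
qed

section \<open>The sequence space \<open>l2\<close>\<close>

lemma l2_summable_norm:
  assumes "x \<in> l2" "y \<in> l2"
  shows "summable (\<lambda>n. norm (cnj (x n) * y n))"
proof (rule summable_comparison_test)
  show "summable (\<lambda>n. (cmod (x n))\<^sup>2 + (cmod (y n))\<^sup>2)"
    using assms by (simp add: l2_def summable_add)
  have "a * b \<le> a\<^sup>2 + b\<^sup>2" if "a \<ge> 0" "b \<ge> 0" for a b :: real
    using that sum_squares_bound[of a b] zero_le_mult_iff[of a b] by linarith
  then show "\<exists>N. \<forall>n\<ge>N. norm (norm (cnj (x n) * y n)) \<le> (cmod (x n))\<^sup>2 + (cmod (y n))\<^sup>2"
    by (simp add: norm_mult)
qed

lemma l2_summable: "x \<in> l2 \<Longrightarrow> y \<in> l2 \<Longrightarrow> summable (\<lambda>n. cnj (x n) * y n)"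
  by (rule summable_norm_cancel) (rule l2_summable_norm)

lemma l2_cmult: "x \<in> l2 \<Longrightarrow> (\<lambda>n. c * x n) \<in> l2"
  by (simp add: l2_def norm_mult power_mult_distrib summable_mult)

lemma l2_add:
  assumes "x \<in> l2" "y \<in> l2"
  shows "(\<lambda>n. x n + y n) \<in> l2"
proof -
  have "(cmod (a + b))\<^sup>2 \<le> 2 * (cmod a)\<^sup>2 + 2 * (cmod b)\<^sup>2" for a b
  proof -
    have "(cmod (a + b))\<^sup>2 \<le> (cmod a + cmod b)\<^sup>2"
      by (intro power_mono norm_triangle_ineq) auto
    also have "\<dots> \<le> 2 * (cmod a)\<^sup>2 + 2 * (cmod b)\<^sup>2"
      using sum_squares_bound[of "cmod a" "cmod b"] by (simp add: power2_sum)
    finally show ?thesis .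
  qed
  moreover have "summable (\<lambda>n. 2 * (cmod (x n))\<^sup>2 + 2 * (cmod (y n))\<^sup>2)"
    using assms by (auto simp: l2_def intro!: summable_add summable_mult)
  ultimately show ?thesis
    unfolding l2_def by (auto intro: summable_comparison_test')
qed

lemma delta_in_l2: "delta j \<in> l2"
proof -
  have "(\<lambda>n. (cmod (delta j n))\<^sup>2) = (\<lambda>n. if n = j then 1 else 0)"
    by (auto simp: delta_def)
  then show ?thesis by (simp add: l2_def)
qed

lemma l2_inner_delta: "l2_inner (delta j) x = x j"
proof -
  have "(\<lambda>n. cnj (delta j n) * x n) = (\<lambda>n. if n = j then x n else 0)"
    by (auto simp: delta_def)
  then show ?thesis
    by (simp add: l2_inner_def sums_unique[OF sums_single, symmetric])
qed

lemma l2_inner_add_right: "\<lbrakk>x \<in> l2; y \<in> l2; z \<in> l2\<rbrakk> \<Longrightarrow>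
    l2_inner x (\<lambda>n. y n + z n) = l2_inner x y + l2_inner x z"
  by (simp add: l2_inner_def distrib_left suminf_add l2_summable)

lemma l2_inner_add_left: "\<lbrakk>x \<in> l2; y \<in> l2; z \<in> l2\<rbrakk> \<Longrightarrow>
    l2_inner (\<lambda>n. x n + y n) z = l2_inner x z + l2_inner y z"
  by (simp add: l2_inner_def distrib_right suminf_add l2_summable)

lemma l2_inner_cmult_right: "x \<in> l2 \<Longrightarrow> y \<in> l2 \<Longrightarrow> l2_inner x (\<lambda>n. c * y n) = c * l2_inner x y"
  by (simp add: l2_inner_def mult.left_commute suminf_mult l2_summable)

lemma l2_inner_cmult_left: "x \<in> l2 \<Longrightarrow> y \<in> l2 \<Longrightarrow> l2_inner (\<lambda>n. c * x n) y = cnj c * l2_inner x y"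
  by (simp add: l2_inner_def mult.assoc suminf_mult l2_summable)

lemma l2_norm_eq: "x \<in> l2 \<Longrightarrow> complex_of_real ((l2_norm x)\<^sup>2) = l2_inner x x"
proof -
  assume x: "x \<in> l2"
  then have "summable (\<lambda>n. (cmod (x n))\<^sup>2)" by (simp add: l2_def)
  then have "complex_of_real (\<Sum>n. (cmod (x n))\<^sup>2) = (\<Sum>n. complex_of_real ((cmod (x n))\<^sup>2))"
    by (rule suminf_of_real)
  moreover have "(\<Sum>n. (cmod (x n))\<^sup>2) \<ge> 0"
    by (rule suminf_nonneg) (use x in \<open>auto simp: l2_def\<close>)
  ultimately show ?thesis
    by (simp add: l2_norm_def l2_inner_def complex_norm_square mult.commute del: of_real_power)
qed

text \<open>Bessel and Riesz-Fischer need orthonormality only; completeness is added in a second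
  locale. Total mass 1 serves to bound L^1 norms by L^2 norms.\<close>

locale orthonormal_seq = prob_space M for M :: "'a measure" +
  fixes \<phi> :: "nat \<Rightarrow> 'a \<Rightarrow> complex"
  assumes sqint_basis: "\<And>j. sqint M (\<phi> j)"
    and orthonormal: "\<And>i j. ip M (\<phi> i) (\<phi> j) = (if i = j then 1 else 0)"
begin

text \<open>For the CMV basis this is the unitary \<open>U\<close>.\<close>

definition coef :: "('a \<Rightarrow> complex) \<Rightarrow> seq" where
  "coef f = (\<lambda>j. ip M (\<phi> j) f)"

definition psum :: "seq \<Rightarrow> nat \<Rightarrow> 'a \<Rightarrow> complex" where
  "psum x n = (\<lambda>z. \<Sum>j<n. x j * \<phi> j z)"

lemma sqint_psum: "sqint M (psum x n)"
  unfolding psum_def by (intro sqint_sum sqint_cmult sqint_basis)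

lemma ip_psum: "sqint M f \<Longrightarrow> ip M f (psum x n) = (\<Sum>j<n. cnj (coef f j) * x j)"
  unfolding psum_def coef_def
  by (subst ip_sum_right) (auto simp: sqint_cmult sqint_basis ip_cmult_right ip_cnj mult.commute)

lemma coef_basis: "coef (\<phi> j) = delta j"
  by (auto simp: coef_def delta_def orthonormal)

lemma coef_psum: "coef (psum x n) = (\<lambda>j. if j < n then x j else 0)"
proof
  fix j
  have "coef (psum x n) j = (\<Sum>i<n. cnj (delta j i) * x i)"
    using ip_psum[OF sqint_basis, of j x n] unfolding coef_basis by (simp add: coef_def)
  also have "\<dots> = (\<Sum>i<n. if i = j then x i else 0)"
    by (intro sum.cong) (auto simp: delta_def)
  finally have "coef (psum x n) j = (\<Sum>i<n. if i = j then x i else 0)" .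
  then show "coef (psum x n) j = (if j < n then x j else 0)"
    by simp
qed

lemma coef_add: "sqint M f \<Longrightarrow> sqint M g \<Longrightarrow> coef (\<lambda>x. f x + g x) = (\<lambda>j. coef f j + coef g j)"
  by (simp add: coef_def ip_add_right sqint_basis)

lemma coef_cmult: "coef (\<lambda>x. c * f x) = (\<lambda>j. c * coef f j)"
  by (simp add: coef_def ip_cmult_right)

lemma coef_sum: "(\<And>i. i \<in> I \<Longrightarrow> sqint M (f i)) \<Longrightarrow>
    coef (\<lambda>x. \<Sum>i\<in>I. f i x) = (\<lambda>j. \<Sum>i\<in>I. coef (f i) j)"
  by (simp add: coef_def ip_sum_right sqint_basis)

lemma coef_cong_AE: "sqint M f \<Longrightarrow> sqint M g \<Longrightarrow> AE x in M. f x = g x \<Longrightarrow> coef f = coef g"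
  unfolding coef_def by (auto intro!: ip_cong_AE simp: sqint_measurable sqint_basis)

lemma norm_psum: "(\<integral>z. (cmod (psum x n z))\<^sup>2 \<partial>M) = (\<Sum>j<n. (cmod (x j))\<^sup>2)"
proof -
  have "ip M (psum x n) (psum x n) = (\<Sum>j<n. complex_of_real ((cmod (x j))\<^sup>2))"
    by (subst ip_psum) (auto simp: sqint_psum coef_psum complex_norm_square mult.commute
        simp del: of_real_power intro!: sum.cong)
  then show ?thesis
    by (simp only: ip_self of_real_sum[symmetric] of_real_eq_iff)
qed

lemma norm_psum_diff:
  assumes "m \<le> n"
  shows "(\<integral>z. (cmod (psum x n z - psum x m z))\<^sup>2 \<partial>M) = (\<Sum>j=m..<n. (cmod (x j))\<^sup>2)"
proof -
  have "psum x n z - psum x m z = psum (\<lambda>j. if j < m then 0 else x j) n z" for z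
  proof -
    have "psum x n z = psum x m z + (\<Sum>j=m..<n. x j * \<phi> j z)"
      using assms by (simp add: psum_def sum.atLeastLessThan_concat lessThan_atLeast0)
    moreover have "psum (\<lambda>j. if j < m then 0 else x j) n z = (\<Sum>j=m..<n. x j * \<phi> j z)"
      unfolding psum_def by (rule sum.mono_neutral_cong_right) auto
    ultimately show ?thesis by simp
  qed
  then have "(\<integral>z. (cmod (psum x n z - psum x m z))\<^sup>2 \<partial>M)
      = (\<Sum>j<n. (cmod (if j < m then 0 else x j))\<^sup>2)"
    by (simp add: norm_psum)
  also have "\<dots> = (\<Sum>j=m..<n. (cmod (x j))\<^sup>2)"
    by (rule sum.mono_neutral_cong_right) auto
  finally show ?thesis .
qed

text \<open>In the expansion of the squared norm of f - p, with p a partial sum of the series of f,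
  the terms <f,p>, <p,f> and <p,p> all equal \<open>S\<close>.\<close>

lemma Bessel:
  assumes f: "sqint M f"
  shows "(\<Sum>j<n. (cmod (coef f j))\<^sup>2) \<le> (\<integral>z. (cmod (f z))\<^sup>2 \<partial>M)"
proof -
  define p where "p = psum (coef f) n"
  define S where "S = (\<Sum>j<n. (cmod (coef f j))\<^sup>2)"
  have p: "sqint M p" by (simp add: p_def sqint_psum)
  have fp: "ip M f p = complex_of_real S"
    unfolding p_def S_def of_real_sum
    by (subst ip_psum[OF f]) (auto simp: complex_norm_square mult.commute
        simp del: of_real_power intro!: sum.cong)
  have pp: "ip M p p = complex_of_real S"
    by (simp add: ip_self p_def norm_psum S_def)
  have "ip M p f = complex_of_real S"
    using ip_cnj[of M f p] fp by simp
  then have "ip M (\<lambda>z. f z - p z) (\<lambda>z. f z - p z)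
      = complex_of_real ((\<integral>z. (cmod (f z))\<^sup>2 \<partial>M) - S)"
    using f p by (simp add: ip_diff_left ip_diff_right sqint_diff fp pp ip_self[of M f])
  then have "(\<integral>z. (cmod (f z - p z))\<^sup>2 \<partial>M) = (\<integral>z. (cmod (f z))\<^sup>2 \<partial>M) - S"
    by (simp only: ip_self of_real_eq_iff)
  moreover have "(\<integral>z. (cmod (f z - p z))\<^sup>2 \<partial>M) \<ge> 0"
    by simp
  ultimately show ?thesis by (simp add: S_def)
qed

lemma coef_in_l2: "sqint M f \<Longrightarrow> coef f \<in> l2"
  unfolding l2_def using Bessel by (auto intro!: summableI_nonneg_bounded)

text \<open>Pointwise |f| is at most (|f|^2 / e + e) / 2, and the constant e integrates to
  e.\<close>

lemma integral_norm_le: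
  assumes f: "sqint M f" and e: "e > 0" and le: "(\<integral>z. (cmod (f z))\<^sup>2 \<partial>M) \<le> e\<^sup>2"
  shows "(\<integral>\<^sup>+z. ennreal (cmod (f z)) \<partial>M) \<le> ennreal e"
proof -
  have "(\<integral>\<^sup>+z. ennreal (cmod (f z)) \<partial>M) \<le> (\<integral>\<^sup>+z. ennreal (((cmod (f z))\<^sup>2 / e + e) / 2) \<partial>M)"
  proof (intro nn_integral_mono ennreal_leI)
    fix z
    have "2 * cmod (f z) * e \<le> (cmod (f z))\<^sup>2 + e\<^sup>2"
      by (rule sum_squares_bound)
    then show "cmod (f z) \<le> ((cmod (f z))\<^sup>2 / e + e) / 2"
      using e by (simp add: field_simps power2_eq_square)
  qed
  also have "\<dots> = ennreal (\<integral>z. ((cmod (f z))\<^sup>2 / e + e) / 2 \<partial>M)"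
    using f e by (intro nn_integral_eq_integral) (auto simp: sqint_def)
  also have "\<dots> \<le> ennreal e"
  proof (rule ennreal_leI)
    have "(\<integral>z. ((cmod (f z))\<^sup>2 / e + e) / 2 \<partial>M) = ((\<integral>z. (cmod (f z))\<^sup>2 \<partial>M) / e + e) / 2"
      using f by (simp add: sqint_def prob_space)
    also have "\<dots> \<le> e"
      using le e by (simp add: field_simps power2_eq_square)
    finally show "(\<integral>z. ((cmod (f z))\<^sup>2 / e + e) / 2 \<partial>M) \<le> e" .
  qed
  finally show ?thesis .
qed

text \<open>A subsequence of the partial sums whose increments are summable in \<open>L\<^sup>1\<close> converges almost
  everywhere, and Fatou's lemma upgrades this to convergence in \<open>L\<^sup>2\<close>.\<close>
lemma Riesz_Fischer_tail:
  assumes x: "x \<in> l2"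
  shows "\<exists>h. sqint M h \<and> (\<forall>n. (\<integral>z. (cmod (h z - psum x n z))\<^sup>2 \<partial>M) \<le> (\<Sum>j. (cmod (x (j + n)))\<^sup>2))"
proof -
  define tail where "tail n = (\<Sum>j. (cmod (x (j + n)))\<^sup>2)" for n
  have sx: "summable (\<lambda>j. (cmod (x j))\<^sup>2)" using x by (simp add: l2_def)
  have part: "(\<Sum>j=m..<n. (cmod (x j))\<^sup>2) \<le> tail m" for m n
  proof -
    have "(\<Sum>j=m..<n. (cmod (x j))\<^sup>2) = (\<Sum>j<n - m. (cmod (x (j + m)))\<^sup>2)"
      by (rule sum.reindex_bij_witness[where i = "\<lambda>j. j + m" and j = "\<lambda>j. j - m"]) auto
    also have "\<dots> \<le> tail m"
      unfolding tail_def by (rule sum_le_suminf) (auto intro: summable_ignore_initial_segment[OF sx])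
    finally show ?thesis .
  qed
  have "tail \<longlonglongrightarrow> 0"
    unfolding tail_def using suminf_exist_split2[OF sx] .
  \<comment> \<open>The rate 1/4 is the square of 1/2: by \<open>integral_norm_le\<close> the
    increments chosen below have L^1 norms bounded by a geometric series.\<close>
  have "\<exists>N. \<forall>n\<ge>N. tail n \<le> (1 / 4) ^ k" for k
    using order_tendstoD(2)[OF \<open>tail \<longlonglongrightarrow> 0\<close>, of "(1 / 4) ^ k"]
    by (auto simp: eventually_sequentially intro: less_imp_le)
  then obtain N where N: "\<And>k n. n \<ge> N k \<Longrightarrow> tail n \<le> (1 / 4) ^ k"
    by metis
  \<comment> \<open>Accumulating the \<open>N i\<close> makes \<open>r\<close> monotone and at least
    \<open>N k\<close>; the extra \<open>k\<close> makes it unbounded.\<close>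
  define r where "r k = (\<Sum>i\<le>k. N i) + k" for k
  have rN: "N k \<le> r k" and rk: "k \<le> r k" for k
    by (auto simp: r_def intro: trans_le_add1 member_le_sum)
  have r: "r k \<le> r (Suc k)" for k
    by (simp add: r_def)
  define g where "g k z = psum x (r (Suc k)) z - psum x (r k) z" for k z
  have g: "sqint M (g k)" for k
    unfolding g_def by (intro sqint_diff sqint_psum)
  have "(\<integral>z. (cmod (g k z))\<^sup>2 \<partial>M) \<le> ((1 / 2) ^ k)\<^sup>2" for k
  proof -
    have "(\<integral>z. (cmod (g k z))\<^sup>2 \<partial>M) \<le> tail (r k)"
      unfolding g_def norm_psum_diff[OF r] by (rule part)
    also have "\<dots> \<le> (1 / 4) ^ k" using N rN by blast
    also have "\<dots> = ((1 / 2) ^ k)\<^sup>2"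
      by (simp add: power2_eq_square flip: power_mult_distrib)
    finally show ?thesis .
  qed
  then have g1: "(\<integral>\<^sup>+z. ennreal (cmod (g k z)) \<partial>M) \<le> ennreal ((1 / 2) ^ k)" for k
    by (intro integral_norm_le g) auto
  have gm [measurable]: "g k \<in> borel_measurable M" for k
    using g by (simp add: sqint_def)
  have "(\<integral>\<^sup>+z. (\<Sum>k. ennreal (cmod (g k z))) \<partial>M) = (\<Sum>k. \<integral>\<^sup>+z. ennreal (cmod (g k z)) \<partial>M)"
    by (rule nn_integral_suminf) measurable
  also have "\<dots> \<le> (\<Sum>k. ennreal ((1 / 2) ^ k))"
    by (intro suminf_le g1) auto
  also have "\<dots> < \<infinity>"
    using summable_geometric[of "1/2 :: real"] by (subst suminf_ennreal2) auto
  finally have "AE z in M. (\<Sum>k. ennreal (cmod (g k z))) \<noteq> \<infinity>"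
    by (intro nn_integral_PInf_AE borel_measurable_suminf) auto
  then have conv: "AE z in M. convergent (\<lambda>k. psum x (r k) z)"
  proof eventually_elim
    case (elim z)
    then have "summable (\<lambda>k. cmod (g k z))"
      by (intro summable_suminf_not_top) auto
    then have "summable (\<lambda>k. g k z)"
      by (rule summable_norm_cancel)
    moreover have "(\<Sum>k<n. g k z) = psum x (r n) z - psum x (r 0) z" for n
      unfolding g_def by (rule sum_lessThan_telescope)
    ultimately have "convergent (\<lambda>n. psum x (r n) z - psum x (r 0) z)"
      by (simp add: summable_iff_convergent)
    then show ?case
      by (simp add: convergent_diff_const_right_iff)
  qed
  have pm [measurable]: "psum x n \<in> borel_measurable M" for n
    using sqint_psum by (simp add: sqint_def)
  define h where "h z = lim (\<lambda>k. psum x (r k) z)" for z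
  have hm [measurable]: "h \<in> borel_measurable M"
    unfolding h_def by (rule borel_measurable_lim_metric) measurable
  have fatou: "(\<integral>\<^sup>+z. ennreal ((cmod (h z - psum x n z))\<^sup>2) \<partial>M) \<le> ennreal (tail n)" for n
  proof -
    have "(\<integral>\<^sup>+z. ennreal ((cmod (h z - psum x n z))\<^sup>2) \<partial>M)
        = (\<integral>\<^sup>+z. liminf (\<lambda>k. ennreal ((cmod (psum x (r k) z - psum x n z))\<^sup>2)) \<partial>M)"
    proof (rule nn_integral_cong_AE)
      show "AE z in M. ennreal ((cmod (h z - psum x n z))\<^sup>2)
          = liminf (\<lambda>k. ennreal ((cmod (psum x (r k) z - psum x n z))\<^sup>2))"
        using conv
      proof eventually_elim
        case (elim z)
        then have "(\<lambda>k. psum x (r k) z) \<longlonglongrightarrow> h z"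
          by (simp add: h_def convergent_LIMSEQ_iff)
        then have "(\<lambda>k. ennreal ((cmod (psum x (r k) z - psum x n z))\<^sup>2))
            \<longlonglongrightarrow> ennreal ((cmod (h z - psum x n z))\<^sup>2)"
          by (intro tendsto_intros)
        then show ?case
          by (intro lim_imp_Liminf[symmetric]) auto
      qed
    qed
    also have "\<dots> \<le> liminf (\<lambda>k. \<integral>\<^sup>+z. ennreal ((cmod (psum x (r k) z - psum x n z))\<^sup>2) \<partial>M)"
      by (rule nn_integral_liminf) measurable
    also have "\<dots> \<le> limsup (\<lambda>k. \<integral>\<^sup>+z. ennreal ((cmod (psum x (r k) z - psum x n z))\<^sup>2) \<partial>M)"
      by (rule Liminf_le_Limsup) simp
    also have "\<dots> \<le> ennreal (tail n)"
    proof (rule Limsup_bounded)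
      show "\<forall>\<^sub>F k in sequentially.
          (\<integral>\<^sup>+z. ennreal ((cmod (psum x (r k) z - psum x n z))\<^sup>2) \<partial>M) \<le> ennreal (tail n)"
        using eventually_ge_at_top[of n]
      proof eventually_elim
        case (elim k)
        then have "n \<le> r k" using rk le_trans by blast
        have "(\<integral>\<^sup>+z. ennreal ((cmod (psum x (r k) z - psum x n z))\<^sup>2) \<partial>M)
            = ennreal (\<integral>z. (cmod (psum x (r k) z - psum x n z))\<^sup>2 \<partial>M)"
          using sqint_diff[OF sqint_psum sqint_psum, of x "r k" x n]
          by (intro nn_integral_eq_integral) (auto simp: sqint_def)
        then show ?case
          unfolding norm_psum_diff[OF \<open>n \<le> r k\<close>] by (simp add: part ennreal_leI)
      qed
    qed
    finally show ?thesis .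
  qed
  have "sqint M h"
    unfolding sqint_def
  proof (intro conjI hm integrableI_bounded)
    \<comment> \<open>\<open>psum x 0\<close> is zero, so the case n = 0 of the Fatou bound controls
      \<open>h\<close> itself.\<close>
    have "(\<integral>\<^sup>+z. ennreal (norm ((cmod (h z))\<^sup>2)) \<partial>M) \<le> ennreal (tail 0)"
      using fatou[of 0] by (simp add: psum_def)
    then show "(\<integral>\<^sup>+z. ennreal (norm ((cmod (h z))\<^sup>2)) \<partial>M) < \<infinity>"
      by (simp add: order_le_less_trans)
  qed measurable
  moreover have "(\<integral>z. (cmod (h z - psum x n z))\<^sup>2 \<partial>M) \<le> tail n" for n
  proof -
    have "integrable M (\<lambda>z. (cmod (h z - psum x n z))\<^sup>2)"
      using sqint_diff[OF \<open>sqint M h\<close> sqint_psum] by (simp add: sqint_def)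
    then have "ennreal (\<integral>z. (cmod (h z - psum x n z))\<^sup>2 \<partial>M) \<le> ennreal (tail n)"
      using fatou[of n] by (subst (asm) nn_integral_eq_integral) auto
    moreover have "tail n \<ge> 0"
      unfolding tail_def by (rule suminf_nonneg) (auto intro: summable_ignore_initial_segment[OF sx])
    ultimately show ?thesis by simp
  qed
  ultimately show ?thesis
    unfolding tail_def by blast
qed

text \<open>The j-th coefficient of the partial sums is \<open>x j\<close> as soon as n > j, and
  coefficients pass to L^2 limits.\<close>

lemma Riesz_Fischer:
  assumes x: "x \<in> l2"
  shows "\<exists>h. sqint M h \<and> coef h = x \<and> (\<lambda>n. \<integral>z. (cmod (h z - psum x n z))\<^sup>2 \<partial>M) \<longlonglongrightarrow> 0"
proof -
  obtain h where h: "sqint M h"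
    and le: "\<And>n. (\<integral>z. (cmod (h z - psum x n z))\<^sup>2 \<partial>M) \<le> (\<Sum>j. (cmod (x (j + n)))\<^sup>2)"
    using Riesz_Fischer_tail[OF x] by blast
  have lim: "(\<lambda>n. \<integral>z. (cmod (h z - psum x n z))\<^sup>2 \<partial>M) \<longlonglongrightarrow> 0"
  proof (rule tendsto_sandwich[OF _ _ tendsto_const])
    show "(\<lambda>n. \<Sum>j. (cmod (x (j + n)))\<^sup>2) \<longlonglongrightarrow> 0"
      using x by (intro suminf_exist_split2) (simp add: l2_def)
  qed (use le in auto)
  have "coef h j = x j" for j
  proof -
    have "(\<lambda>n. coef (psum x n) j) \<longlonglongrightarrow> coef h j"
      unfolding coef_def by (rule ip_tendsto[OF sqint_basis h sqint_psum lim])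
    moreover have "(\<lambda>n. coef (psum x n) j) \<longlonglongrightarrow> x j"
      unfolding coef_psum
      by (rule tendsto_eventually, rule eventually_mono[OF eventually_gt_at_top[of j]]) simp
    ultimately show ?thesis by (rule LIMSEQ_unique)
  qed
  then show ?thesis using h lim by blast
qed

end

locale orthonormal_basis = orthonormal_seq +
  assumes total: "sqint M f \<Longrightarrow> (\<And>j. ip M (\<phi> j) f = 0) \<Longrightarrow> AE z in M. f z = 0"
begin

lemma coef_eq_imp_AE:
  assumes f: "sqint M f" and g: "sqint M g" and eq: "coef f = coef g"
  shows "AE z in M. f z = g z"
proof -
  have "ip M (\<phi> j) (\<lambda>z. f z - g z) = 0" for j
    using f g fun_cong[OF eq, of j] by (simp add: ip_diff_right sqint_basis coef_def)
  then show ?thesis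
    using total[OF sqint_diff[OF f g]] by simp
qed

text \<open>Riesz-Fischer yields an h that is the L^2 limit of the partial sums for
  \<open>coef g\<close>; completeness identifies h with g almost everywhere, and pairing with f is
  continuous.\<close>

lemma Parseval:
  assumes f: "sqint M f" and g: "sqint M g"
  shows "l2_inner (coef f) (coef g) = ip M f g"
proof -
  obtain h where h: "sqint M h" and hg: "coef h = coef g"
    and lim: "(\<lambda>n. \<integral>z. (cmod (h z - psum (coef g) n z))\<^sup>2 \<partial>M) \<longlonglongrightarrow> 0"
    using Riesz_Fischer[OF coef_in_l2[OF g]] by blast
  have "AE z in M. h z = g z" by (rule coef_eq_imp_AE[OF h g hg])
  then have "ip M f h = ip M f g"
    using f g h by (intro ip_cong_AE) (auto simp: sqint_measurable)
  then have "(\<lambda>n. ip M f (psum (coef g) n)) \<longlonglongrightarrow> ip M f g"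
    using ip_tendsto[OF f h sqint_psum lim] by simp
  then have "(\<lambda>j. cnj (coef f j) * coef g j) sums ip M f g"
    by (simp add: ip_psum[OF f] sums_def)
  then show ?thesis
    by (simp add: l2_inner_def sums_iff)
qed

end

subsection \<open>Orthogonal polynomials and the CMV basis\<close>

text \<open>The reversed polynomial of the Szego recursion. Its own degree drops when
  \<open>p\<close> vanishes at 0.\<close>

definition star :: "complex poly \<Rightarrow> complex poly" where
  "star p = reflect_poly (map_poly cnj p)"

lemma degree_map_poly_cnj: "degree (map_poly cnj p) = degree p"
  by (rule degree_map_poly) simp

lemma poly_star: "z \<noteq> 0 \<Longrightarrow> poly (star p) z = z ^ degree p * cnj (poly p (1 / cnj z))"
  by (simp add: star_def poly_reflect_poly_nz degree_map_poly_cnj inverse_eq_divide)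

lemma poly_star_circle: "z \<in> sphere 0 1 \<Longrightarrow> poly (star p) z = z ^ degree p * cnj (poly p z)"
proof -
  assume z: "z \<in> sphere 0 1"
  then have "z \<noteq> 0" by auto
  moreover have "1 / cnj z = z"
    using circle_power_mult_cnj[OF z, of 1] \<open>z \<noteq> 0\<close> by (simp add: field_simps)
  ultimately show ?thesis by (simp add: poly_star)
qed

lemma degree_star: "degree (star p) \<le> degree p"
  unfolding star_def using degree_reflect_poly_le degree_map_poly_cnj by metis

lemma poly_star_0: "poly (star p) 0 = cnj (lead_coeff p)"
  by (simp add: star_def degree_map_poly_cnj coeff_map_poly)

text \<open>Cancelling the top coefficient lowers the degree, except that for n = 0 the remainder is
  the zero polynomial, whose degree is not below 0; hence the disjunction.\<close>

lemma degree_diff_smult_less: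
  fixes p q :: "complex poly"
  assumes "degree p \<le> n" "degree q = n" "lead_coeff q = 1"
  defines "r \<equiv> p - smult (coeff p n) q"
  shows "r = 0 \<or> degree r < n"
proof -
  have "degree r \<le> n"
    unfolding r_def using assms(1,2) degree_smult_le[of "coeff p n" q]
    by (intro degree_diff_le) auto
  moreover have "coeff r n = 0"
    using assms(2,3) by (simp add: r_def)
  ultimately show ?thesis
    by (metis leading_coeff_0_iff order_le_less)
qed

locale circle_measure = prob_space \<mu> for \<mu> :: "complex measure" +
  assumes sets_circle: "sets \<mu> = sets circle_borel"
    and nontrivial: "nontrivial_meas \<mu>"
begin

lemma space_circle: "space \<mu> = sphere 0 1"
  by (rule space_circle_borel[OF sets_circle])

lemma sqint_continuous:
  assumes "continuous_on (sphere 0 1) f"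
  shows "sqint \<mu> f"
  unfolding sqint_def
  by (intro conjI borel_measurable_circle_continuous[OF sets_circle]
      integrable_circle_continuous[OF finite_measure_axioms sets_circle] continuous_intros assms)

lemma ip_cong:
  assumes "\<And>z. z \<in> sphere 0 1 \<Longrightarrow> f z = f' z" "\<And>z. z \<in> sphere 0 1 \<Longrightarrow> g z = g' z"
  shows "ip \<mu> f g = ip \<mu> f' g'"
  unfolding ip_def using assms by (intro Bochner_Integration.integral_cong) (auto simp: space_circle)

lemma ip_mult_z: "ip \<mu> (\<lambda>z. z ^ k * f z) (\<lambda>z. z ^ k * g z) = ip \<mu> f g"
  unfolding ip_def
proof (intro Bochner_Integration.integral_cong refl)
  fix z assume "z \<in> space \<mu>"
  then have "z ^ k * cnj z ^ k = 1" by (simp add: space_circle circle_power_mult_cnj)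
  moreover have "cnj (z ^ k * f z) * (z ^ k * g z) = (z ^ k * cnj z ^ k) * (cnj (f z) * g z)"
    by (simp add: algebra_simps)
  ultimately show "cnj (z ^ k * f z) * (z ^ k * g z) = cnj (f z) * g z" by simp
qed

lemma sqint_poly: "sqint \<mu> (poly p)"
  by (intro sqint_continuous continuous_intros)

text \<open>Nontriviality enters here: a finite set of roots cannot carry the measure. Consequently
  the inner product is definite on polynomials.\<close>

lemma poly_AE_zero:
  assumes "AE z in \<mu>. poly p z = 0"
  shows "p = 0"
proof (rule ccontr)
  assume "p \<noteq> 0"
  then have "finite {z. poly p z = 0}" by (rule poly_roots_finite)
  then show False
    using nontrivial assms unfolding nontrivial_meas_def by auto
qed

lemma ip_poly_self_eq_0:
  assumes "ip \<mu> (poly p) (poly p) = 0"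
  shows "p = 0"
proof -
  have "(\<integral>z. (cmod (poly p z))\<^sup>2 \<partial>\<mu>) = 0"
    using assms by (simp only: ip_self of_real_eq_0_iff)
  then have "AE z in \<mu>. (cmod (poly p z))\<^sup>2 = 0"
    using sqint_poly[of p] by (subst (asm) integral_nonneg_eq_0_iff_AE) (auto simp: sqint_def)
  then show ?thesis by (intro poly_AE_zero) simp
qed

section \<open>Monic orthogonal polynomials and the Szego recursion\<close>

lemma ip_lower_poly:
  assumes f: "sqint \<mu> f" and orth: "\<And>k. k < n \<Longrightarrow> ip \<mu> f (\<lambda>z. z ^ k) = 0"
    and q: "q = 0 \<or> degree q < n"
  shows "ip \<mu> f (poly q) = 0"
proof (cases "q = 0")
  case True
  then show ?thesis by (simp add: ip_def)
next
  case False
  then have deg: "degree q < n" using q by simp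
  have "ip \<mu> f (poly q) = ip \<mu> f (\<lambda>z. \<Sum>i\<le>degree q. coeff q i * z ^ i)"
    by (intro ip_cong) (simp_all add: poly_altdef)
  also have "\<dots> = (\<Sum>i\<le>degree q. ip \<mu> f (\<lambda>z. coeff q i * z ^ i))"
    by (intro ip_sum_right f sqint_continuous continuous_intros)
  also have "\<dots> = 0"
    using deg orth by (intro sum.neutral) (auto simp: ip_cmult_right)
  finally show ?thesis .
qed

text \<open>The predicate inside the description \<open>monic_OP\<close>, isolated so that existence
  and uniqueness can be proved for it.\<close>

definition is_OP :: "nat \<Rightarrow> complex poly \<Rightarrow> bool" where
  "is_OP n p \<longleftrightarrow> degree p = n \<and> lead_coeff p = 1 \<and>
     (\<forall>k<n. (\<integral>z. poly p z * cnj (z ^ k) \<partial>\<mu>) = 0)"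

lemma is_OP_iff: "is_OP n p \<longleftrightarrow> degree p = n \<and> lead_coeff p = 1 \<and>
     (\<forall>k<n. ip \<mu> (poly p) (\<lambda>z. z ^ k) = 0)"
proof -
  have "(\<integral>z. poly p z * cnj (z ^ k) \<partial>\<mu>) = cnj (ip \<mu> (poly p) (\<lambda>z. z ^ k))" for k
    by (simp add: ip_cnj) (simp add: ip_def mult.commute)
  then show ?thesis by (simp add: is_OP_def)
qed

lemma is_OP_coeff: "is_OP n p \<Longrightarrow> coeff p n = 1"
  by (auto simp: is_OP_def)

lemma is_OP_ip:
  assumes p: "is_OP n p" and q: "degree q \<le> n"
  shows "ip \<mu> (poly p) (poly q) = coeff q n * ip \<mu> (poly p) (poly p)"
proof -
  have "ip \<mu> (poly p) (poly (q - smult (coeff q n) p)) = 0"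
    using p q degree_diff_smult_less[of q n p]
    by (intro ip_lower_poly[of _ n] sqint_poly) (auto simp: is_OP_iff)
  moreover have "ip \<mu> (poly p) (poly (q - smult (coeff q n) p))
      = ip \<mu> (poly p) (\<lambda>z. poly q z - coeff q n * poly p z)"
    by (intro ip_cong) simp_all
  ultimately show ?thesis
    by (simp add: ip_diff_right ip_cmult_right sqint_poly sqint_cmult)
qed

text \<open>The difference of two candidates has lower degree, so it is orthogonal to both and hence
  to itself.\<close>

lemma is_OP_unique:
  assumes "is_OP n p" "is_OP n q"
  shows "p = q"
proof -
  have r: "p - q = 0 \<or> degree (p - q) < n"
    using degree_diff_smult_less[of p n q] is_OP_coeff[OF assms(1)] is_OP_coeff[OF assms(2)] assms
    by (simp add: is_OP_def)
  have "ip \<mu> (poly p') (poly (p - q)) = 0" if "is_OP n p'" for p'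
    using that r by (intro ip_lower_poly[of _ n] sqint_poly) (auto simp: is_OP_iff)
  then have "ip \<mu> (poly p) (poly (p - q)) = 0" "ip \<mu> (poly q) (poly (p - q)) = 0"
    using assms by blast+
  moreover have "ip \<mu> (poly (p - q)) (poly (p - q))
      = ip \<mu> (\<lambda>z. poly p z - poly q z) (poly (p - q))"
    by (intro ip_cong) simp_all
  ultimately have "ip \<mu> (poly (p - q)) (poly (p - q)) = 0"
    by (simp add: ip_diff_left sqint_poly)
  then show ?thesis using ip_poly_self_eq_0 by fastforce
qed

lemma is_OP_self_nonzero: "is_OP n p \<Longrightarrow> ip \<mu> (poly p) (poly p) \<noteq> 0"
  using ip_poly_self_eq_0 by (fastforce simp: is_OP_def)

text \<open>On the circle \<open>star p\<close> is z^n times the conjugate of p, so pairing it with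
  z^k amounts to pairing p with z^(n-k); only k = 0 meets the top power.\<close>

lemma ip_star:
  assumes p: "is_OP n p" and k: "k \<le> n"
  shows "ip \<mu> (poly (star p)) (\<lambda>z. z ^ k) = (if k = 0 then ip \<mu> (poly p) (poly p) else 0)"
proof -
  have "ip \<mu> (poly (star p)) (\<lambda>z. z ^ k)
      = ip \<mu> (\<lambda>z. z ^ k * (z ^ (n - k) * cnj (poly p z))) (\<lambda>z. z ^ k * 1)"
    using p k by (intro ip_cong)
      (auto simp: poly_star_circle is_OP_def simp flip: mult.assoc power_add)
  also have "\<dots> = ip \<mu> (\<lambda>z. z ^ (n - k) * cnj (poly p z)) (\<lambda>z. 1)"
    by (rule ip_mult_z)
  also have "\<dots> = cnj (ip \<mu> (poly p) (poly (monom 1 (n - k))))"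
    unfolding ip_cnj by (simp add: ip_def poly_monom mult.commute)
  also have "ip \<mu> (poly p) (poly (monom 1 (n - k)))
      = coeff (monom 1 (n - k)) n * ip \<mu> (poly p) (poly p)"
    by (rule is_OP_ip[OF p]) (simp add: degree_monom_eq)
  finally show ?thesis
    using k by (auto simp: ip_cnj)
qed

text \<open>Both z p and \<open>star p\<close> are orthogonal to z, ..., z^n, so one free
  coefficient suffices to gain orthogonality to 1. Existence of all orthogonal polynomials follows
  by induction.\<close>

lemma Szego_step:
  assumes p: "is_OP n p"
  shows "\<exists>a. is_OP (Suc n) (pCons 0 p - smult (cnj a) (star p))"
proof -
  define N where "N = ip \<mu> (poly p) (poly p)"
  have N0: "N \<noteq> 0" using is_OP_self_nonzero[OF p] by (simp add: N_def)
  \<comment> \<open>Since <star p, 1> = N, this value cancels the pairing with 1; the conjugate on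
    \<open>a\<close> in \<open>q\<close> is undone by the conjugate-linear first argument.\<close>
  define a where "a = ip \<mu> (\<lambda>z. z * poly p z) (\<lambda>z. 1) / N"
  define q where "q = pCons 0 p - smult (cnj a) (star p)"
  have deg: "degree p = n" "lead_coeff p = 1" "p \<noteq> 0"
    using p by (auto simp: is_OP_def)
  have ds: "degree (smult (cnj a) (star p)) < Suc n"
    using degree_smult_le[of "cnj a" "star p"] degree_star[of p] deg by linarith
  have dp: "degree (pCons 0 p) = Suc n" using deg by simp
  have "degree q \<le> Suc n"
    unfolding q_def using dp ds by (intro degree_diff_le) auto
  moreover have "coeff q (Suc n) = 1"
    unfolding q_def coeff_diff using coeff_eq_0[OF ds] deg by simp
  ultimately have dq: "degree q = Suc n" "lead_coeff q = 1"
    using le_degree[of q "Suc n"] by auto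
  have qz: "ip \<mu> (poly q) (\<lambda>z. z ^ k)
      = ip \<mu> (\<lambda>z. z * poly p z) (\<lambda>z. z ^ k) - a * ip \<mu> (poly (star p)) (\<lambda>z. z ^ k)" for k
  proof -
    have "ip \<mu> (poly q) (\<lambda>z. z ^ k)
        = ip \<mu> (\<lambda>z. z * poly p z - cnj a * poly (star p) z) (\<lambda>z. z ^ k)"
      by (intro ip_cong) (simp_all add: q_def)
    also have "\<dots> = ip \<mu> (\<lambda>z. z * poly p z) (\<lambda>z. z ^ k) - a * ip \<mu> (poly (star p)) (\<lambda>z. z ^ k)"
      by (subst ip_diff_left) (auto simp: ip_cmult_left intro!: sqint_continuous continuous_intros)
    finally show ?thesis .
  qed
  have "ip \<mu> (poly q) (\<lambda>z. z ^ k) = 0" if "k < Suc n" for k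
  proof (cases k)
    case 0
    then show ?thesis
      unfolding qz using ip_star[OF p, of 0] N0 by (simp add: a_def N_def)
  next
    case (Suc j)
    have "ip \<mu> (\<lambda>z. z * poly p z) (\<lambda>z. z ^ k) = ip \<mu> (poly p) (\<lambda>z. z ^ j)"
      using ip_mult_z[of 1 "poly p" "\<lambda>z. z ^ j"] by (simp add: Suc)
    then show ?thesis
      unfolding qz using ip_star[OF p, of k] p that Suc by (simp add: is_OP_iff)
  qed
  then have "is_OP (Suc n) q"
    using dq by (simp add: is_OP_iff)
  then show ?thesis unfolding q_def by blast
qed

lemma is_OP_exists: "\<exists>p. is_OP n p"
proof (induction n)
  case 0
  have "is_OP 0 1" by (simp add: is_OP_def)
  then show ?case by blast
next
  case (Suc n)
  then show ?case using Szego_step by blast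
qed

abbreviation OP :: "nat \<Rightarrow> complex poly" where "OP \<equiv> monic_OP \<mu>"
abbreviation V :: "nat \<Rightarrow> complex" where "V \<equiv> verblunsky \<mu>"

lemma is_OP_OP: "is_OP n (OP n)"
proof -
  have "\<exists>!p. is_OP n p" using is_OP_exists is_OP_unique by blast
  then have "is_OP n (THE p. is_OP n p)" by (rule theI')
  then show ?thesis unfolding monic_OP_def is_OP_def .
qed

lemma degree_OP: "degree (OP n) = n" and lead_coeff_OP: "lead_coeff (OP n) = 1"
  using is_OP_OP unfolding is_OP_def by blast+

text \<open>\<open>star (OP n)\<close> has constant term 1 and so is not zero; this makes the
  coefficient unique and the description \<open>verblunsky\<close> meaningful.\<close>

lemma Szego_recursion: "OP (Suc n) = pCons 0 (OP n) - smult (cnj (V n)) (star (OP n))"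
proof -
  obtain a where "is_OP (Suc n) (pCons 0 (OP n) - smult (cnj a) (star (OP n)))"
    using Szego_step[OF is_OP_OP] by blast
  then have a: "OP (Suc n) = pCons 0 (OP n) - smult (cnj a) (star (OP n))"
    using is_OP_unique is_OP_OP by blast
  have "verblunsky \<mu> n = a"
    unfolding verblunsky_def
  proof (rule the_equality)
    show "\<forall>z. z \<noteq> 0 \<longrightarrow> poly (OP (Suc n)) z =
       z * poly (OP n) z - cnj a * (z ^ n * cnj (poly (OP n) (1 / cnj z)))"
      by (simp add: a poly_star degree_OP)
  next
    fix b
    assume "\<forall>z. z \<noteq> 0 \<longrightarrow> poly (OP (Suc n)) z =
       z * poly (OP n) z - cnj b * (z ^ n * cnj (poly (OP n) (1 / cnj z)))"
    then have "poly (OP (Suc n)) z = z * poly (OP n) z - cnj b * poly (star (OP n)) z"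
      if "z \<noteq> 0" for z
      using that by (simp add: poly_star degree_OP)
    then have "poly (smult (cnj a - cnj b) (star (OP n))) z = 0" if "z \<noteq> 0" for z
      using that by (simp add: a left_diff_distrib)
    \<comment> \<open>The excluded point 0 is not on the circle.\<close>
    then have zero: "poly (smult (cnj a - cnj b) (star (OP n))) z = 0" if "z \<in> space \<mu>" for z
      using that by (cases "z = 0") (simp_all add: space_circle)
    have "AE z in \<mu>. poly (smult (cnj a - cnj b) (star (OP n))) z = 0"
      by (rule AE_I2) (rule zero)
    then have "smult (cnj a - cnj b) (star (OP n)) = 0" by (rule poly_AE_zero)
    moreover have "star (OP n) \<noteq> 0"
      using poly_star_0[of "OP n"] by (auto simp: lead_coeff_OP)
    ultimately show "b = a" by simp
  qed
  then show ?thesis using a by simp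
qed

definition norm2 :: "nat \<Rightarrow> real" where
  "norm2 n = (\<integral>z. (cmod (poly (OP n) z))\<^sup>2 \<partial>\<mu>)"

lemma ip_OP_self: "ip \<mu> (poly (OP n)) (poly (OP n)) = complex_of_real (norm2 n)"
  by (simp add: ip_self norm2_def)

lemma norm2_pos: "norm2 n > 0"
proof -
  have "norm2 n \<noteq> 0"
    using is_OP_self_nonzero[OF is_OP_OP] by (simp add: ip_OP_self)
  moreover have "norm2 n \<ge> 0" by (simp add: norm2_def)
  ultimately show ?thesis by simp
qed

text \<open>The recursion splits z \<open>OP n\<close> orthogonally, because
  \<open>star (OP n)\<close> has degree at most n, and \<open>star (OP n)\<close> has the norm of
  \<open>OP n\<close> because their moduli agree on the circle.\<close>

lemma norm2_Suc: "norm2 (Suc n) = (1 - (cmod (V n))\<^sup>2) * norm2 n"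
proof -
  let ?P = "poly (OP n)" and ?S = "poly (star (OP n))" and ?R = "poly (OP (Suc n))"
  have SS: "ip \<mu> ?S ?S = norm2 n"
  proof -
    have "ip \<mu> ?S ?S = ip \<mu> (\<lambda>z. z ^ n * cnj (?P z)) (\<lambda>z. z ^ n * cnj (?P z))"
      by (intro ip_cong) (auto simp: poly_star_circle degree_OP)
    also have "\<dots> = ip \<mu> ?P ?P"
      unfolding ip_mult_z by (simp add: ip_def mult.commute)
    finally show ?thesis by (simp add: ip_OP_self)
  qed
  have RS: "ip \<mu> ?R ?S = 0"
    using is_OP_ip[OF is_OP_OP, of "star (OP n)" "Suc n"] degree_star[of "OP n"]
    by (simp add: degree_OP coeff_eq_0)
  then have SR: "ip \<mu> ?S ?R = 0"
    using ip_cnj[of \<mu> ?R ?S] by simp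
  have "complex_of_real (norm2 n) = ip \<mu> (\<lambda>z. z * ?P z) (\<lambda>z. z * ?P z)"
    using ip_mult_z[of 1 ?P ?P] by (simp add: ip_OP_self)
  also have "\<dots> = ip \<mu> (\<lambda>z. ?R z + cnj (V n) * ?S z) (\<lambda>z. ?R z + cnj (V n) * ?S z)"
    by (simp add: Szego_recursion)
  also have "\<dots> = complex_of_real (norm2 (Suc n)) + V n * cnj (V n) * norm2 n"
    by (simp add: ip_add_left ip_add_right ip_cmult_left ip_cmult_right sqint_poly sqint_cmult
        sqint_add SS RS SR ip_OP_self)
  finally have "complex_of_real (norm2 n)
      = complex_of_real (norm2 (Suc n) + (cmod (V n))\<^sup>2 * norm2 n)"
    by (simp only: complex_norm_square of_real_add of_real_mult)
  then show ?thesis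
    by (simp only: of_real_eq_iff) (simp add: algebra_simps)
qed

lemma verblunsky_less_1: "(cmod (V n))\<^sup>2 < 1"
  using norm2_Suc[of n] norm2_pos[of n] norm2_pos[of "Suc n"]
  by (simp add: zero_less_mult_iff)

abbreviation r :: "nat \<Rightarrow> complex" where "r n \<equiv> rho (V n)"

lemma rho_nonzero: "r n \<noteq> 0"
  using verblunsky_less_1[of n] by (simp add: rho_def)

lemma cnj_rho: "cnj (r n) = r n"
  by (simp add: rho_def)

lemma rho_square: "r n * r n + V n * cnj (V n) = 1"
proof -
  have "r n * r n = complex_of_real (1 - (cmod (V n))\<^sup>2)"
    using verblunsky_less_1[of n] by (simp add: rho_def flip: of_real_mult)
  then show ?thesis
    by (simp only: complex_norm_square of_real_diff) simp
qed

definition OPN :: "nat \<Rightarrow> complex \<Rightarrow> complex" where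
  "OPN n z = poly (OP n) z / complex_of_real (sqrt (norm2 n))"

text \<open>Agrees with the normalised reversed polynomial on the circle only, so the recursions
  below assume z on the sphere.\<close>

definition OPS :: "nat \<Rightarrow> complex \<Rightarrow> complex" where
  "OPS n z = z ^ n * cnj (OPN n z)"

text \<open>By \<open>norm2_Suc\<close> consecutive normalising factors differ by the factor
  \<open>r n\<close>; this is how rho enters.\<close>

lemma OPN_forward:
  assumes z: "z \<in> sphere 0 1"
  shows "z * OPN n z = r n * OPN (Suc n) z + cnj (V n) * OPS n z"
proof -
  define s where "s = complex_of_real (sqrt (norm2 n))"
  have s: "s \<noteq> 0" "cnj s = s" using norm2_pos[of n] by (auto simp: s_def)
  have "complex_of_real (sqrt (norm2 (Suc n))) = r n * s"
    by (simp add: norm2_Suc real_sqrt_mult rho_def s_def)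
  then have e1: "r n * (s * OPN (Suc n) z) = poly (OP (Suc n)) z"
    using s rho_nonzero[of n] by (simp add: OPN_def)
  have e2: "s * OPS n z = poly (star (OP n)) z"
    using z s by (simp add: OPS_def OPN_def poly_star_circle degree_OP flip: s_def)
  have e3: "s * OPN n z = poly (OP n) z"
    using s by (simp add: OPN_def flip: s_def)
  have "s * (z * OPN n z) = s * (r n * OPN (Suc n) z + cnj (V n) * OPS n z)"
    unfolding distrib_left mult.left_commute[of s] e1 e2 e3 by (simp add: Szego_recursion)
  then show ?thesis using s by simp
qed

text \<open>The conjugate of \<open>OPN_forward\<close>, multiplied by z^(n+1).\<close>

lemma OPS_forward:
  assumes z: "z \<in> sphere 0 1"
  shows "OPS n z = r n * OPS (Suc n) z + V n * (z * OPN n z)"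
proof -
  have u: "z * cnj z = 1" and un: "z ^ n * cnj z ^ n = 1"
    using circle_power_mult_cnj[OF z, of 1] circle_power_mult_cnj[OF z, of n] by auto
  have "z ^ Suc n * cnj (z * OPN n z) = (z * cnj z) * OPS n z"
    by (simp add: OPS_def)
  then have "OPS n z = z ^ Suc n * cnj (z * OPN n z)"
    using u by simp
  also have "\<dots> = z ^ Suc n * (r n * cnj (OPN (Suc n) z) + V n * (cnj z ^ n * OPN n z))"
    by (simp add: OPN_forward[OF z] cnj_rho OPS_def)
  also have "\<dots> = r n * OPS (Suc n) z + V n * (z * OPN n z) * (z ^ n * cnj z ^ n)"
    by (simp add: OPS_def algebra_simps)
  finally show ?thesis using un by simp
qed

text \<open>Eliminates \<open>OPS n\<close> from the forward recursions. Together with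
  \<open>OPS_forward\<close> it expresses (\<open>OPS n\<close>, \<open>OPN (Suc n)\<close>) through
  (z \<open>OPN n\<close>, \<open>OPS (Suc n)\<close>) by the conjugate of
  \<open>Theta (V n)\<close>.\<close>

lemma OPN_Suc:
  assumes z: "z \<in> sphere 0 1"
  shows "OPN (Suc n) z = r n * (z * OPN n z) - cnj (V n) * OPS (Suc n) z"
proof -
  have "r n * OPN (Suc n) z = z * OPN n z - cnj (V n) * OPS n z"
    using OPN_forward[OF z, of n] by simp
  also have "\<dots> = (1 - V n * cnj (V n)) * (z * OPN n z) - cnj (V n) * (r n * OPS (Suc n) z)"
    unfolding OPS_forward[OF z, of n] by (simp add: algebra_simps)
  also have "1 - V n * cnj (V n) = r n * r n"
    using rho_square[of n] by (simp add: algebra_simps)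
  finally have "r n * OPN (Suc n) z = r n * (r n * (z * OPN n z) - cnj (V n) * OPS (Suc n) z)"
    by (simp add: algebra_simps)
  then show ?thesis using rho_nonzero by simp
qed

text \<open>The CMV basis (orthonormalising \<open>1, z, 1/z, z\<^sup>2, 1/z\<^sup>2, \<dots>\<close>) and the alternate CMV
  basis (orthonormalising \<open>1, 1/z, z, \<dots>\<close>); \<open>cnj z\<close> plays the role of \<open>1/z\<close>.\<close>
definition X :: "nat \<Rightarrow> complex \<Rightarrow> complex" where
  "X j z = cnj z ^ (j div 2) * (if even j then OPS j z else OPN j z)"

definition Y :: "nat \<Rightarrow> complex \<Rightarrow> complex" where
  "Y j z = cnj z ^ (Suc j div 2) * (if even j then OPN j z else OPS j z)"

lemma Y_0: "Y 0 z = X 0 z"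
proof -
  have "OP 0 = 1"
    using is_OP_unique[OF is_OP_OP, of 0 1] by (simp add: is_OP_def)
  then show ?thesis by (simp add: X_def Y_def OPN_def OPS_def)
qed

lemma cnj_shift: "z \<in> sphere 0 1 \<Longrightarrow> cnj z ^ Suc k * (a * (z * b)) = cnj z ^ k * (a * b)"
proof -
  assume "z \<in> sphere 0 1"
  then have "z * cnj z = 1" using circle_power_mult_cnj[of z 1] by simp
  moreover have "cnj z ^ Suc k * (a * (z * b)) = (z * cnj z) * (cnj z ^ k * (a * b))"
    by (simp add: algebra_simps)
  ultimately show ?thesis by simp
qed

text \<open>One conjugate power absorbs the factor z beside \<open>OPN n\<close>, so that for the
  right k every term is a member of the families \<open>X\<close> and \<open>Y\<close>, up to one
  factor \<open>cnj z\<close>.\<close>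

lemma OPS_shift:
  assumes z: "z \<in> sphere 0 1"
  shows "cnj z ^ Suc k * OPS n z
      = r n * (cnj z ^ Suc k * OPS (Suc n) z) + V n * (cnj z ^ k * OPN n z)"
proof -
  have "cnj z ^ Suc k * OPS n z
      = cnj z ^ Suc k * (r n * OPS (Suc n) z) + cnj z ^ Suc k * (V n * (z * OPN n z))"
    by (subst OPS_forward[OF z, of n]) (rule distrib_left)
  also have "\<dots> = r n * (cnj z ^ Suc k * OPS (Suc n) z) + V n * (cnj z ^ k * OPN n z)"
    unfolding cnj_shift[OF z] by (simp only: mult.left_commute)
  finally show ?thesis .
qed

lemma OPN_shift:
  assumes z: "z \<in> sphere 0 1"
  shows "cnj z ^ Suc k * OPN (Suc n) z
      = r n * (cnj z ^ k * OPN n z) - cnj (V n) * (cnj z ^ Suc k * OPS (Suc n) z)"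
proof -
  have "cnj z ^ Suc k * OPN (Suc n) z
      = cnj z ^ Suc k * (r n * (z * OPN n z)) - cnj z ^ Suc k * (cnj (V n) * OPS (Suc n) z)"
    by (subst OPN_Suc[OF z, of n]) (rule right_diff_distrib)
  also have "\<dots> = r n * (cnj z ^ k * OPN n z) - cnj (V n) * (cnj z ^ Suc k * OPS (Suc n) z)"
    unfolding cnj_shift[OF z] by (simp only: mult.left_commute)
  finally show ?thesis .
qed

lemma X_Y_simps:
  "X (2 * n) z = cnj z ^ n * OPS (2 * n) z"
  "X (Suc (2 * n)) z = cnj z ^ n * OPN (Suc (2 * n)) z"
  "Y (2 * n) z = cnj z ^ n * OPN (2 * n) z"
  "Y (Suc (2 * n)) z = cnj z ^ Suc n * OPS (Suc (2 * n)) z"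
  by (simp_all add: X_def Y_def)

lemma X_Y_Suc_Suc:
  "X (Suc (Suc (2 * n))) z = cnj z ^ Suc n * OPS (Suc (Suc (2 * n))) z"
  "Y (Suc (Suc (2 * n))) z = cnj z ^ Suc n * OPN (Suc (Suc (2 * n))) z"
  using X_Y_simps(1,3)[of "Suc n" z] by simp_all

text \<open>This and the next three relations are the conjugated blocks of M (from \<open>X\<close>
  to \<open>Y\<close>) and of L (from \<open>Y\<close> to \<open>cnj z * X\<close>). The conjugation
  disappears once these functions stand on the left of \<open>ip\<close>.\<close>

lemma Y_odd: "z \<in> sphere 0 1 \<Longrightarrow> Y (Suc (2 * n)) z
    = r (Suc (2 * n)) * X (Suc (Suc (2 * n))) z + V (Suc (2 * n)) * X (Suc (2 * n)) z"
  unfolding X_Y_simps X_Y_Suc_Suc by (rule OPS_shift)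

lemma Y_even: "z \<in> sphere 0 1 \<Longrightarrow> Y (Suc (Suc (2 * n))) z
    = r (Suc (2 * n)) * X (Suc (2 * n)) z - cnj (V (Suc (2 * n))) * X (Suc (Suc (2 * n))) z"
  unfolding X_Y_simps X_Y_Suc_Suc by (rule OPN_shift)

lemma X_even: "z \<in> sphere 0 1 \<Longrightarrow>
    cnj z * X (2 * n) z = r (2 * n) * Y (Suc (2 * n)) z + V (2 * n) * Y (2 * n) z"
  unfolding X_Y_simps mult.assoc[symmetric] power_Suc[symmetric]
  unfolding mult.assoc by (rule OPS_shift)

lemma X_odd: "z \<in> sphere 0 1 \<Longrightarrow>
    cnj z * X (Suc (2 * n)) z = r (2 * n) * Y (2 * n) z - cnj (V (2 * n)) * Y (Suc (2 * n)) z"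
  unfolding X_Y_simps mult.assoc[symmetric] power_Suc[symmetric]
  unfolding mult.assoc by (rule OPN_shift)

lemma continuous_OPN: "continuous_on A (OPN n)"
  unfolding OPN_def using norm2_pos[of n] by (intro continuous_intros) auto

lemma continuous_OPS: "continuous_on A (OPS n)"
  unfolding OPS_def by (intro continuous_intros continuous_OPN)

lemma continuous_X: "continuous_on A (X n)"
  unfolding X_def by (cases "even n") (auto intro!: continuous_intros continuous_OPN continuous_OPS)

lemma continuous_Y: "continuous_on A (Y n)"
  unfolding Y_def by (cases "even n") (auto intro!: continuous_intros continuous_OPN continuous_OPS)

lemma sqint_X: "sqint \<mu> (X n)" and sqint_Y: "sqint \<mu> (Y n)"
  by (intro sqint_continuous continuous_X continuous_Y)+

end

section \<open>Rows of the block matrices L and M\<close>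

lemma suminf_two:
  fixes f :: "nat \<Rightarrow> 'a::{comm_monoid_add,t2_space}"
  assumes "a \<noteq> b" and "\<And>s. s \<noteq> a \<Longrightarrow> s \<noteq> b \<Longrightarrow> f s = 0"
  shows "suminf f = f a + f b"
  using suminf_finite[of "{a, b}" f] assms by auto

lemma mat_op_CMV_M_0: "mat_op (CMV_M \<alpha>) x 0 = x 0"
  unfolding mat_op_def using suminf_finite[of "{0}" "\<lambda>s. CMV_M \<alpha> 0 s * x s"]
  by (simp add: CMV_M_def)

text \<open>Row 2n+1 of M meets only the columns 2n+1 and 2n+2, so the series is a finite sum for
  every \<open>x\<close>, square-summable or not.\<close>

lemma mat_op_CMV_M_odd: "mat_op (CMV_M \<alpha>) x (Suc (2 * n))
    = cnj (\<alpha> (Suc (2 * n))) * x (Suc (2 * n)) + rho (\<alpha> (Suc (2 * n))) * x (Suc (Suc (2 * n)))"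
proof -
  have "mat_op (CMV_M \<alpha>) x (Suc (2 * n))
      = CMV_M \<alpha> (Suc (2 * n)) (Suc (2 * n)) * x (Suc (2 * n))
        + CMV_M \<alpha> (Suc (2 * n)) (Suc (Suc (2 * n))) * x (Suc (Suc (2 * n)))"
    unfolding mat_op_def
  proof (rule suminf_two)
    fix s assume "s \<noteq> Suc (2 * n)" "s \<noteq> Suc (Suc (2 * n))"
    then have "(s + 1) div 2 \<noteq> Suc n" by presburger
    then show "CMV_M \<alpha> (Suc (2 * n)) s * x s = 0" by (simp add: CMV_M_def)
  qed simp
  then show ?thesis by (simp add: CMV_M_def Theta_def)
qed

lemma mat_op_CMV_M_even: "mat_op (CMV_M \<alpha>) x (Suc (Suc (2 * n)))
    = rho (\<alpha> (Suc (2 * n))) * x (Suc (2 * n)) - \<alpha> (Suc (2 * n)) * x (Suc (Suc (2 * n)))"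
proof -
  have "mat_op (CMV_M \<alpha>) x (Suc (Suc (2 * n)))
      = CMV_M \<alpha> (Suc (Suc (2 * n))) (Suc (2 * n)) * x (Suc (2 * n))
        + CMV_M \<alpha> (Suc (Suc (2 * n))) (Suc (Suc (2 * n))) * x (Suc (Suc (2 * n)))"
    unfolding mat_op_def
  proof (rule suminf_two)
    fix s assume "s \<noteq> Suc (2 * n)" "s \<noteq> Suc (Suc (2 * n))"
    then have "(s + 1) div 2 \<noteq> Suc n" by presburger
    then show "CMV_M \<alpha> (Suc (Suc (2 * n))) s * x s = 0" by (simp add: CMV_M_def)
  qed simp
  then show ?thesis by (simp add: CMV_M_def Theta_def)
qed

lemma mat_op_CMV_L_even: "mat_op (CMV_L \<alpha>) x (2 * n)
    = cnj (\<alpha> (2 * n)) * x (2 * n) + rho (\<alpha> (2 * n)) * x (Suc (2 * n))"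
proof -
  have "mat_op (CMV_L \<alpha>) x (2 * n)
      = CMV_L \<alpha> (2 * n) (2 * n) * x (2 * n) + CMV_L \<alpha> (2 * n) (Suc (2 * n)) * x (Suc (2 * n))"
    unfolding mat_op_def
  proof (rule suminf_two)
    fix s assume "s \<noteq> 2 * n" "s \<noteq> Suc (2 * n)"
    then have "n \<noteq> s div 2" by presburger
    then show "CMV_L \<alpha> (2 * n) s * x s = 0" by (simp add: CMV_L_def)
  qed simp
  then show ?thesis by (simp add: CMV_L_def Theta_def)
qed

lemma mat_op_CMV_L_odd: "mat_op (CMV_L \<alpha>) x (Suc (2 * n))
    = rho (\<alpha> (2 * n)) * x (2 * n) - \<alpha> (2 * n) * x (Suc (2 * n))"
proof -
  have "mat_op (CMV_L \<alpha>) x (Suc (2 * n))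
      = CMV_L \<alpha> (Suc (2 * n)) (2 * n) * x (2 * n)
        + CMV_L \<alpha> (Suc (2 * n)) (Suc (2 * n)) * x (Suc (2 * n))"
    unfolding mat_op_def
  proof (rule suminf_two)
    fix s assume "s \<noteq> 2 * n" "s \<noteq> Suc (2 * n)"
    then have "n \<noteq> s div 2" by presburger
    then show "CMV_L \<alpha> (Suc (2 * n)) s * x s = 0" by (simp add: CMV_L_def)
  qed simp
  then show ?thesis by (simp add: CMV_L_def Theta_def)
qed

lemma nat_even_odd_cases:
  obtains (even) n where "k = 2 * n" | (odd) n where "k = Suc (2 * n)"
  by (metis evenE oddE Suc_eq_plus1)

section \<open>Orthonormality of the CMV basis\<close>

lemma ip_cnj_power: "ip M (\<lambda>z. cnj (h z) ^ k * f z) g = ip M f (\<lambda>z. h z ^ k * g z)"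
  by (simp add: ip_def mult.assoc mult.left_commute)

context circle_measure
begin

text \<open>The space of functions on the right does not involve the measure; this allows the CMV
  bases of two measures to be compared.\<close>

lemma X_form: "\<exists>p. degree p \<le> j \<and> (\<forall>z\<in>sphere 0 1. X j z = cnj z ^ (j div 2) * poly p z)"
proof -
  define c where "c = 1 / complex_of_real (sqrt (norm2 j))"
  have "degree (smult c (OP j)) \<le> j" "degree (smult c (star (OP j))) \<le> j"
    using degree_smult_le[of c "OP j"] degree_smult_le[of c "star (OP j)"] degree_star[of "OP j"]
    by (auto simp: degree_OP)
  moreover have "X j z = cnj z ^ (j div 2) * poly (smult c (if even j then star (OP j) else OP j)) z"
    if "z \<in> sphere 0 1" for z
    using that by (simp add: X_def OPS_def OPN_def c_def poly_star_circle degree_OP)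
  ultimately show ?thesis
    by (intro exI[of _ "smult c (if even j then star (OP j) else OP j)"]) auto
qed

lemma ip_OPN_lower:
  assumes "degree q < n"
  shows "ip \<mu> (OPN n) (poly q) = 0"
proof -
  have "ip \<mu> (OPN n) (poly q)
      = ip \<mu> (\<lambda>z. 1 / complex_of_real (sqrt (norm2 n)) * poly (OP n) z) (poly q)"
    by (intro ip_cong) (simp_all add: OPN_def)
  also have "\<dots> = 0"
    unfolding ip_cmult_left using assms is_OP_ip[OF is_OP_OP, of q n] by (simp add: coeff_eq_0)
  finally show ?thesis .
qed

text \<open>Multiplying by a power of \<open>z\<close> turns both pairings into one of \<open>OPN i\<close> with a polynomial of
  lower degree.\<close>
lemma ip_X_lower:
  assumes "degree p \<le> j" "j < i"
  shows "ip \<mu> (X i) (\<lambda>z. cnj z ^ (j div 2) * poly p z) = 0"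
proof -
  define m where "m = i div 2"
  define l where "l = j div 2"
  show ?thesis
  proof (cases "even i")
    case False
    then have i: "i = Suc (2 * m)" by (auto simp: m_def)
    then have lm: "l \<le> m" and jlm: "j \<le> l + m" using \<open>j < i\<close> by (auto simp: l_def)
    have "ip \<mu> (X i) (\<lambda>z. cnj z ^ l * poly p z)
        = ip \<mu> (OPN i) (\<lambda>z. z ^ m * (cnj z ^ l * poly p z))"
      unfolding ip_cnj_power[of \<mu> "\<lambda>z. z", symmetric] by (intro ip_cong) (simp_all add: i X_def)
    also have "\<dots> = ip \<mu> (OPN i) (poly (monom 1 (m - l) * p))"
    proof (intro ip_cong refl)
      fix z :: complex assume "z \<in> sphere 0 1"
      then have "z ^ l * cnj z ^ l = 1" by (rule circle_power_mult_cnj)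
      moreover have "z ^ m = z ^ (m - l) * z ^ l"
        using lm by (simp flip: power_add)
      ultimately show "z ^ m * (cnj z ^ l * poly p z) = poly (monom 1 (m - l) * p) z"
        by (simp add: poly_monom mult.assoc)
    qed
    also have "\<dots> = 0"
    proof (rule ip_OPN_lower)
      have "degree (monom 1 (m - l) * p) \<le> degree (monom (1::complex) (m - l)) + degree p"
        by (rule degree_mult_le)
      then show "degree (monom 1 (m - l) * p) < i"
        using assms lm jlm i by (simp add: degree_monom_eq)
    qed
    finally show ?thesis by (simp add: l_def)
  next
    case True
    then have i: "i = 2 * m" by (auto simp: m_def)
    then have lm: "l < m" and jlm: "j \<le> l + m" using \<open>j < i\<close> by (auto simp: l_def)
    \<comment> \<open>On the circle this is z^(m+l) times the conjugate of p: \<open>star p\<close>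
      already carries the power \<open>degree p\<close>. The truncated subtraction is exact because
      degree p \<le> j \<le> m + l.\<close>
    let ?q = "monom 1 (m + l - degree p) * star p"
    have "ip \<mu> (X i) (\<lambda>z. cnj z ^ l * poly p z) = ip \<mu> (poly ?q) (OPN i)"
      unfolding ip_def
    proof (intro Bochner_Integration.integral_cong refl)
      fix z assume "z \<in> space \<mu>"
      then have z: "z \<in> sphere 0 1" by (simp add: space_circle)
      have 1: "z ^ m * cnj z ^ m = 1" by (rule circle_power_mult_cnj[OF z])
      have "X i z = (z ^ m * cnj z ^ m) * (z ^ m * cnj (OPN i z))"
        using power_add[of z m m] by (simp add: i X_def OPS_def mult_ac[where 'a = complex] flip: mult_2)
      moreover have "poly ?q z = z ^ (m + l - degree p) * z ^ degree p * cnj (poly p z)"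
        by (simp add: poly_monom poly_star_circle[OF z])
      moreover have "z ^ (m + l - degree p) * z ^ degree p = z ^ m * z ^ l"
        using assms(1) jlm by (simp flip: power_add)
      ultimately show "cnj (X i z) * (cnj z ^ l * poly p z) = cnj (poly ?q z) * OPN i z"
        by (simp only: 1) (simp add: mult_ac)
    qed
    also have "\<dots> = cnj (ip \<mu> (OPN i) (poly ?q))"
      by (simp add: ip_cnj)
    also have "ip \<mu> (OPN i) (poly ?q) = 0"
    proof (rule ip_OPN_lower)
      have "degree ?q \<le> degree (monom (1::complex) (m + l - degree p)) + degree (star p)"
        by (rule degree_mult_le)
      also have "\<dots> \<le> m + l - degree p + degree p"
        using degree_star[of p] by (simp add: degree_monom_eq)
      finally show "degree ?q < i"
        using assms jlm lm i by simp
    qed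
    finally show ?thesis by (simp add: l_def)
  qed
qed

lemma norm_X: "z \<in> sphere 0 1 \<Longrightarrow> cmod (X j z) = cmod (OPN j z)"
  by (simp add: X_def OPS_def norm_mult norm_power)

lemma ip_X_X: "ip \<mu> (X i) (X j) = (if i = j then 1 else 0)"
proof -
  have lt: "ip \<mu> (X i) (X j) = 0" if "j < i" for i j
  proof -
    obtain p where p: "degree p \<le> j" "\<And>z. z \<in> sphere 0 1 \<Longrightarrow> X j z = cnj z ^ (j div 2) * poly p z"
      using X_form by blast
    then have "ip \<mu> (X i) (X j) = ip \<mu> (X i) (\<lambda>z. cnj z ^ (j div 2) * poly p z)"
      by (intro ip_cong) simp_all
    then show ?thesis using ip_X_lower[OF p(1) that] by simp
  qed
  have self: "ip \<mu> (X j) (X j) = 1"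
  proof -
    have "(\<integral>z. (cmod (X j z))\<^sup>2 \<partial>\<mu>) = (\<integral>z. (cmod (poly (OP j) z))\<^sup>2 / norm2 j \<partial>\<mu>)"
      using norm2_pos[of j]
      by (intro Bochner_Integration.integral_cong)
        (auto simp: norm_X space_circle OPN_def norm_divide power_divide)
    also have "\<dots> = 1"
      using norm2_pos[of j] by (simp add: norm2_def)
    finally show ?thesis by (simp add: ip_self)
  qed
  have "ip \<mu> (X i) (X j) = 0" if "i < j"
    using lt[OF that] ip_cnj[of \<mu> "X j" "X i"] by simp
  then show ?thesis
    using lt self by (cases i j rule: linorder_cases) auto
qed

section \<open>Multiplication by z in the CMV basis\<close>

lemma ip_Y_0: "ip \<mu> (Y 0) f = ip \<mu> (X 0) f"
  by (intro ip_cong) (simp_all add: Y_0)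

lemma ip_Y_odd:
  assumes f: "sqint \<mu> f"
  shows "ip \<mu> (Y (Suc (2 * n))) f = cnj (V (Suc (2 * n))) * ip \<mu> (X (Suc (2 * n))) f
      + r (Suc (2 * n)) * ip \<mu> (X (Suc (Suc (2 * n)))) f"
proof -
  have "ip \<mu> (Y (Suc (2 * n))) f = ip \<mu> (\<lambda>z. r (Suc (2 * n)) * X (Suc (Suc (2 * n))) z
      + V (Suc (2 * n)) * X (Suc (2 * n)) z) f"
    by (intro ip_cong refl) (rule Y_odd)
  then show ?thesis
    using f by (simp add: ip_add_left ip_cmult_left sqint_cmult sqint_X cnj_rho)
qed

lemma ip_Y_even:
  assumes f: "sqint \<mu> f"
  shows "ip \<mu> (Y (Suc (Suc (2 * n)))) f = r (Suc (2 * n)) * ip \<mu> (X (Suc (2 * n))) f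
      - V (Suc (2 * n)) * ip \<mu> (X (Suc (Suc (2 * n)))) f"
proof -
  have "ip \<mu> (Y (Suc (Suc (2 * n)))) f = ip \<mu> (\<lambda>z. r (Suc (2 * n)) * X (Suc (2 * n)) z
      - cnj (V (Suc (2 * n))) * X (Suc (Suc (2 * n))) z) f"
    by (intro ip_cong refl) (rule Y_even)
  then show ?thesis
    using f by (simp add: ip_diff_left ip_cmult_left sqint_cmult sqint_X cnj_rho)
qed

lemma ip_X_even:
  assumes f: "sqint \<mu> f"
  shows "ip \<mu> (X (2 * n)) (\<lambda>z. z * f z) = cnj (V (2 * n)) * ip \<mu> (Y (2 * n)) f
      + r (2 * n) * ip \<mu> (Y (Suc (2 * n))) f"
proof -
  have "ip \<mu> (X (2 * n)) (\<lambda>z. z * f z) = ip \<mu> (\<lambda>z. cnj z * X (2 * n) z) f"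
    using ip_cnj_power[of \<mu> "\<lambda>z. z" 1] by simp
  also have "\<dots> = ip \<mu> (\<lambda>z. r (2 * n) * Y (Suc (2 * n)) z + V (2 * n) * Y (2 * n) z) f"
    by (intro ip_cong refl) (rule X_even)
  finally show ?thesis
    using f by (simp add: ip_add_left ip_cmult_left sqint_cmult sqint_Y cnj_rho)
qed

lemma ip_X_odd:
  assumes f: "sqint \<mu> f"
  shows "ip \<mu> (X (Suc (2 * n))) (\<lambda>z. z * f z) = r (2 * n) * ip \<mu> (Y (2 * n)) f
      - V (2 * n) * ip \<mu> (Y (Suc (2 * n))) f"
proof -
  have "ip \<mu> (X (Suc (2 * n))) (\<lambda>z. z * f z) = ip \<mu> (\<lambda>z. cnj z * X (Suc (2 * n)) z) f"
    using ip_cnj_power[of \<mu> "\<lambda>z. z" 1] by simp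
  also have "\<dots> = ip \<mu> (\<lambda>z. r (2 * n) * Y (2 * n) z - cnj (V (2 * n)) * Y (Suc (2 * n)) z) f"
    by (intro ip_cong refl) (rule X_odd)
  finally show ?thesis
    using f by (simp add: ip_diff_left ip_cmult_left sqint_cmult sqint_Y cnj_rho)
qed

section \<open>Completeness of the CMV basis\<close>

lemma sqint_mult_continuous:
  assumes f: "sqint \<mu> f" and h: "continuous_on (sphere 0 1) h"
  shows "sqint \<mu> (\<lambda>z. h z * f z)"
proof -
  have "compact (h ` sphere 0 1)"
    using h compact_continuous_image compact_sphere by blast
  then obtain B where "\<And>z. z \<in> sphere 0 1 \<Longrightarrow> norm (h z) \<le> B"
    by (metis bounded_iff compact_imp_bounded imageI)
  then show ?thesis
    by (intro sqint_mult_bounded[OF f borel_measurable_circle_continuous[OF sets_circle h]] AE_I2)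
      (simp add: space_circle)
qed

text \<open>\<open>Theta\<close> is unitary: the combinations formed are the rows of its adjoint
  applied to \<open>Theta\<close> (u, v).\<close>

lemma Theta_injective:
  assumes "cnj (V n) * u + r n * v = 0" "r n * u - V n * v = 0"
  shows "u = 0" "v = 0"
proof -
  have "(r n * r n + V n * cnj (V n)) * u
      = V n * (cnj (V n) * u + r n * v) + r n * (r n * u - V n * v)"
    by (simp add: algebra_simps)
  then show "u = 0" unfolding rho_square assms by simp
  have "(r n * r n + V n * cnj (V n)) * v
      = r n * (cnj (V n) * u + r n * v) - cnj (V n) * (r n * u - V n * v)"
    by (simp add: algebra_simps)
  then show "v = 0" unfolding rho_square assms by simp
qed

text \<open>M turns vanishing pairings with \<open>X\<close> into vanishing pairings with
  \<open>Y\<close>, and L carries these to the pairings of z f with \<open>X\<close>.\<close>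

lemma orthogonal_mult_z:
  assumes f: "sqint \<mu> f" and zero: "\<And>j. ip \<mu> (X j) f = 0"
  shows "ip \<mu> (X j) (\<lambda>z. z * f z) = 0"
proof -
  have Y: "ip \<mu> (Y k) f = 0" for k
  proof (cases k)
    case 0
    then show ?thesis by (simp add: ip_Y_0 zero)
  next
    case (Suc l)
    then show ?thesis
      using ip_Y_odd[OF f] ip_Y_even[OF f] by (cases l rule: nat_even_odd_cases) (simp_all add: zero)
  qed
  show ?thesis
    using ip_X_odd[OF f] ip_X_even[OF f] by (cases j rule: nat_even_odd_cases) (simp_all add: Y)
qed

text \<open>For g = \<open>cnj z\<close> f one has z g = f, so the same passage runs backwards
  through L and then M, each block being injective.\<close>

lemma orthogonal_mult_cnj_z:
  assumes f: "sqint \<mu> f" and zero: "\<And>j. ip \<mu> (X j) f = 0"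
  shows "ip \<mu> (X j) (\<lambda>z. cnj z * f z) = 0"
proof -
  define g where "g z = cnj z * f z" for z
  have g: "sqint \<mu> g"
    unfolding g_def by (rule sqint_mult_continuous[OF f]) (intro continuous_intros)
  have zg: "ip \<mu> (X j) (\<lambda>z. z * g z) = 0" for j
  proof -
    have "ip \<mu> (X j) (\<lambda>z. z * g z) = ip \<mu> (X j) f"
    proof (intro ip_cong refl)
      fix z :: complex assume "z \<in> sphere 0 1"
      then have "z * cnj z = 1" using circle_power_mult_cnj[of z 1] by simp
      then show "z * g z = f z" by (simp add: g_def mult.assoc[symmetric])
    qed
    then show ?thesis by (simp add: zero)
  qed
  have "ip \<mu> (Y (2 * n)) g = 0 \<and> ip \<mu> (Y (Suc (2 * n))) g = 0" for n
    using Theta_injective[of "2 * n"] ip_X_even[OF g, of n] ip_X_odd[OF g, of n] zg by metis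
  then have Y: "ip \<mu> (Y k) g = 0" for k
    by (cases k rule: nat_even_odd_cases) auto
  have "ip \<mu> (X (Suc (2 * n))) g = 0 \<and> ip \<mu> (X (Suc (Suc (2 * n)))) g = 0" for n
    using Theta_injective[of "Suc (2 * n)"] ip_Y_odd[OF g, of n] ip_Y_even[OF g, of n] Y by metis
  \<comment> \<open>Index 0 forms the one-dimensional block of M, where \<open>Y 0\<close> equals
    \<open>X 0\<close>.\<close>
  moreover have "ip \<mu> (X 0) g = 0"
    using Y[of 0] by (simp add: ip_Y_0)
  ultimately have "ip \<mu> (X j) g = 0"
    by (metis nat_even_odd_cases not0_implies_Suc)
  then show ?thesis unfolding g_def .
qed

text \<open>The positive and negative parts of g are densities of finite measures with equal
  moments. The measures coincide, so the parts agree almost everywhere, and then both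
  vanish.\<close>

lemma real_moments_zero_imp_AE:
  fixes g :: "complex \<Rightarrow> real"
  assumes g: "integrable \<mu> g" and zero: "\<And>n::nat. (\<integral>z. z ^ n * complex_of_real (g z) \<partial>\<mu>) = 0"
  shows "AE z in \<mu>. g z = 0"
proof -
  define M where "M s = density \<mu> (\<lambda>z. ennreal (max 0 (s * g z)))" for s :: real
  have gm [measurable]: "g \<in> borel_measurable \<mu>" using g by simp
  have zm [measurable]: "(\<lambda>z. z ^ n) \<in> borel_measurable \<mu>" for n
    by (intro borel_measurable_circle_continuous[OF sets_circle] continuous_intros)
  have int: "integrable \<mu> (\<lambda>z. max 0 (s * g z))" for s
    using g by (intro Bochner_Integration.integrable_max) auto
  have fin: "finite_measure (M s)" for s
  proof
    have "emeasure (M s) (space (M s)) = (\<integral>\<^sup>+z. ennreal (max 0 (s * g z)) \<partial>\<mu>)"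
      unfolding M_def by (subst emeasure_density) (auto intro!: nn_integral_cong)
    also have "\<dots> = ennreal (\<integral>z. max 0 (s * g z) \<partial>\<mu>)"
      using int by (intro nn_integral_eq_integral) auto
    finally show "emeasure (M s) (space (M s)) \<noteq> \<infinity>" by simp
  qed
  have mom: "(\<integral>z. z ^ n \<partial>M s) = (\<integral>z. z ^ n * complex_of_real (max 0 (s * g z)) \<partial>\<mu>)" for s n
    unfolding M_def by (subst integral_density) (auto simp: scaleR_conv_of_real mult.commute)
  have intz: "integrable \<mu> (\<lambda>z. z ^ n * complex_of_real (max 0 (s * g z)))" for n s
  proof (rule Bochner_Integration.integrable_bound)
    show "integrable \<mu> (\<lambda>z. max 0 (s * g z))" by (rule int)
    show "AE z in \<mu>. norm (z ^ n * complex_of_real (max 0 (s * g z))) \<le> norm (max 0 (s * g z))"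
      by (rule AE_I2) (simp add: space_circle norm_mult norm_power)
  qed measurable
  have "(\<integral>z. z ^ n \<partial>M 1) - (\<integral>z. z ^ n \<partial>M (-1))
      = (\<integral>z. z ^ n * complex_of_real (max 0 (1 * g z)) - z ^ n * complex_of_real (max 0 (- 1 * g z)) \<partial>\<mu>)"
    for n
    unfolding mom using intz by (intro Bochner_Integration.integral_diff[symmetric])
  also have "\<And>n. (\<integral>z. z ^ n * complex_of_real (max 0 (1 * g z))
        - z ^ n * complex_of_real (max 0 (- 1 * g z)) \<partial>\<mu>) = (\<integral>z. z ^ n * complex_of_real (g z) \<partial>\<mu>)"
    by (intro Bochner_Integration.integral_cong refl) (simp add: max_def)
  finally have "M 1 = M (-1)"
    by (intro moments_determine_measure fin) (simp_all add: M_def sets_circle zero)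
  then have "AE z in \<mu>. ennreal (max 0 (g z)) = ennreal (max 0 (- g z))"
    unfolding M_def by (subst (asm) finite_density_unique)
      (auto simp: nn_integral_eq_integral[OF int, of 1, simplified])
  then show ?thesis
    by eventually_elim (auto simp: max_def ennreal_eq_0_iff split: if_splits)
qed

text \<open>The complement of the basis is stable under z and \<open>cnj z\<close>, so pairing with
  \<open>X 0\<close> = 1 shows that all moments of f vanish.\<close>

lemma X_total:
  assumes f: "sqint \<mu> f" and zero: "\<And>j. ip \<mu> (X j) f = 0"
  shows "AE z in \<mu>. f z = 0"
proof -
  have sq: "sqint \<mu> (\<lambda>z. z ^ n * f z)" "sqint \<mu> (\<lambda>z. cnj z ^ n * f z)" for n
    by (intro sqint_mult_continuous[OF f] continuous_intros)+
  have z: "ip \<mu> (X j) (\<lambda>z. z ^ n * f z) = 0" for n j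
  proof (induction n arbitrary: j)
    case (Suc n)
    then show ?case
      using orthogonal_mult_z[OF sq(1)[of n]] by (simp add: mult.assoc)
  qed (simp add: zero)
  have c: "ip \<mu> (X j) (\<lambda>z. cnj z ^ n * f z) = 0" for n j
  proof (induction n arbitrary: j)
    case (Suc n)
    then show ?case
      using orthogonal_mult_cnj_z[OF sq(2)[of n]] by (simp add: mult.assoc)
  qed (simp add: zero)
  have X0: "X 0 z = 1" for z
    using is_OP_unique[OF is_OP_OP, of 0 1]
    by (simp add: is_OP_def X_def OPS_def OPN_def norm2_def prob_space)
  have m: "(\<integral>z. z ^ n * f z \<partial>\<mu>) = 0" for n
    using z[of 0 n] by (simp add: ip_def X0)
  have "(\<integral>z. cnj z ^ n * f z \<partial>\<mu>) = 0" for n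
    using c[of 0 n] by (simp add: ip_def X0)
  \<comment> \<open>Conjugating the negative moments of f gives the nonnegative moments of
    \<open>cnj f\<close>; both families together separate real and imaginary parts.\<close>
  then have "(\<integral>z. cnj (cnj z ^ n * f z) \<partial>\<mu>) = 0" for n
    by (metis Bochner_Integration.integral_cnj complex_cnj_zero)
  then have mc: "(\<integral>z. z ^ n * cnj (f z) \<partial>\<mu>) = 0" for n by simp
  have one: "sqint \<mu> (\<lambda>_. 1)" by (intro sqint_continuous continuous_intros)
  have int: "integrable \<mu> (\<lambda>z. z ^ n * f z)" "integrable \<mu> (\<lambda>z. z ^ n * cnj (f z))" for n
    using sqint_integrable_ip[OF one sq(1)[of n]]
      sqint_integrable_ip[OF sq(2)[of n] one] by simp_all
  have intf: "integrable \<mu> f" using int(1)[of 0] by simp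
  have "(\<integral>z. z ^ n * complex_of_real (Re (f z)) \<partial>\<mu>)
      = (\<integral>z. (1/2) * (z ^ n * f z) + (1/2) * (z ^ n * cnj (f z)) \<partial>\<mu>)" for n
    by (intro Bochner_Integration.integral_cong refl) (simp add: complex_eq_iff field_simps)
  then have re: "AE z in \<mu>. Re (f z) = 0"
    using int m mc intf by (intro real_moments_zero_imp_AE) simp_all
  have "(\<integral>z. z ^ n * complex_of_real (Im (f z)) \<partial>\<mu>)
      = (\<integral>z. (- \<i>/2) * (z ^ n * f z) + (\<i>/2) * (z ^ n * cnj (f z)) \<partial>\<mu>)" for n
  proof (intro Bochner_Integration.integral_cong refl)
    fix z
    have Im: "complex_of_real (Im w) = (- \<i>/2) * w + (\<i>/2) * cnj w" for w
      by (simp add: complex_eq_iff)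
    show "z ^ n * complex_of_real (Im (f z))
        = (- \<i>/2) * (z ^ n * f z) + (\<i>/2) * (z ^ n * cnj (f z))"
      by (subst Im) (simp add: algebra_simps)
  qed
  then have im: "AE z in \<mu>. Im (f z) = 0"
    using int m mc intf by (intro real_moments_zero_imp_AE) simp_all
  from re im show ?thesis
    by eventually_elim (simp add: complex_eq_iff)
qed

sublocale orthonormal_basis \<mu> X
  by unfold_locales (auto simp: sqint_X ip_X_X X_total)

lemma sqint_z: "sqint \<mu> f \<Longrightarrow> sqint \<mu> (\<lambda>z. z ^ n * f z)"
  by (intro sqint_mult_continuous continuous_intros)

text \<open>M takes the pairings of f with \<open>X\<close> to those with \<open>Y\<close>, and L
  takes these to the pairings of z f with \<open>X\<close>.\<close>

lemma CMV_of_coef: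
  assumes f: "sqint \<mu> f"
  shows "CMV_of \<mu> (coef f) = coef (\<lambda>z. z * f z)"
proof -
  have M: "mat_op (CMV_M V) (coef f) = (\<lambda>k. ip \<mu> (Y k) f)"
  proof
    fix k
    show "mat_op (CMV_M V) (coef f) k = ip \<mu> (Y k) f"
    proof (cases k)
      case 0
      then show ?thesis by (simp add: ip_Y_0 mat_op_CMV_M_0 coef_def)
    next
      case (Suc l)
      then show ?thesis
        using ip_Y_odd[OF f] ip_Y_even[OF f]
        by (cases l rule: nat_even_odd_cases)
          (simp_all add: mat_op_CMV_M_odd mat_op_CMV_M_even coef_def)
    qed
  qed
  have "mat_op (CMV_L V) (\<lambda>k. ip \<mu> (Y k) f) k = coef (\<lambda>z. z * f z) k" for k
    using ip_X_odd[OF f] ip_X_even[OF f]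
    by (cases k rule: nat_even_odd_cases)
      (simp_all add: mat_op_CMV_L_odd mat_op_CMV_L_even coef_def)
  then show ?thesis
    by (auto simp: CMV_of_def CMV_op_def M)
qed

lemma CMV_of_power_coef:
  assumes f: "sqint \<mu> f"
  shows "(CMV_of \<mu> ^^ n) (coef f) = coef (\<lambda>z. z ^ n * f z)"
  by (induction n) (simp_all add: CMV_of_coef sqint_z f mult.assoc)

end

subsection \<open>Functional calculus of the CMV matrix\<close>

lemma bounded_op_in_l2: "bounded_op T \<Longrightarrow> x \<in> l2 \<Longrightarrow> T x \<in> l2"
  by (auto simp: bounded_op_def)

lemma bounded_op_add:
  "bounded_op T \<Longrightarrow> x \<in> l2 \<Longrightarrow> y \<in> l2 \<Longrightarrow> T (\<lambda>n. x n + y n) = (\<lambda>n. T x n + T y n)"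
  by (simp add: bounded_op_def)

lemma bounded_op_cmult: "bounded_op T \<Longrightarrow> x \<in> l2 \<Longrightarrow> T (\<lambda>n. c * x n) = (\<lambda>n. c * T x n)"
  by (simp add: bounded_op_def)

lemma l2_zero: "(\<lambda>_. 0) \<in> l2"
  by (simp add: l2_def)

lemma bounded_op_zero: "bounded_op T \<Longrightarrow> T (\<lambda>_. 0) = (\<lambda>_. 0)"
  using bounded_op_cmult[of T "\<lambda>_. 0" 0] by (simp add: l2_zero)

lemma l2_sum: "(\<And>i. i \<in> I \<Longrightarrow> x i \<in> l2) \<Longrightarrow> (\<lambda>n. \<Sum>i\<in>I. x i n) \<in> l2"
  by (induction I rule: infinite_finite_induct) (auto simp: l2_zero l2_add)

lemma bounded_op_sum:
  "\<lbrakk>finite I; bounded_op T; \<And>i. i \<in> I \<Longrightarrow> x i \<in> l2\<rbrakk> \<Longrightarrow>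
    T (\<lambda>n. \<Sum>i\<in>I. c i * x i n) = (\<lambda>n. \<Sum>i\<in>I. c i * T (x i) n)"
proof (induction I rule: finite_induct)
  case empty
  then show ?case by (simp add: bounded_op_zero)
next
  case (insert j I)
  have "(\<lambda>n. \<Sum>i\<in>I. c i * x i n) \<in> l2"
    using insert by (intro l2_sum l2_cmult) auto
  then have "T (\<lambda>n. c j * x j n + (\<Sum>i\<in>I. c i * x i n))
      = (\<lambda>n. T (\<lambda>n. c j * x j n) n + T (\<lambda>n. \<Sum>i\<in>I. c i * x i n) n)"
    using insert by (intro bounded_op_add l2_cmult) auto
  then show ?case
    using insert by (simp add: bounded_op_cmult)
qed

lemma l2_inner_sum_right:
  "\<lbrakk>finite I; y \<in> l2; \<And>i. i \<in> I \<Longrightarrow> x i \<in> l2\<rbrakk> \<Longrightarrow>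
    l2_inner y (\<lambda>n. \<Sum>i\<in>I. c i * x i n) = (\<Sum>i\<in>I. c i * l2_inner y (x i))"
proof (induction I rule: finite_induct)
  case empty
  then show ?case by (simp add: l2_inner_def)
next
  case (insert j I)
  have "(\<lambda>n. \<Sum>i\<in>I. c i * x i n) \<in> l2"
    using insert by (intro l2_sum l2_cmult) auto
  then show ?case
    using insert by (simp add: l2_inner_add_right l2_cmult l2_inner_cmult_right)
qed

text \<open>Polarisation: the forms at y + c x for c = 1 and c = i isolate the sesquilinear
  form.\<close>

lemma bounded_op_eqI_quadratic:
  assumes A: "bounded_op A" and B: "bounded_op B"
    and eq: "\<And>x. x \<in> l2 \<Longrightarrow> l2_inner x (A x) = l2_inner x (B x)"
    and x: "x \<in> l2"
  shows "A x = B x"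
proof -
  have pol: "c * l2_inner y (A x) + cnj c * l2_inner x (A y)
      = c * l2_inner y (B x) + cnj c * l2_inner x (B y)" if y: "y \<in> l2" for y c
  proof -
    have exp: "l2_inner (\<lambda>n. y n + c * x n) (T (\<lambda>n. y n + c * x n))
        = l2_inner y (T y) + c * l2_inner y (T x) + cnj c * l2_inner x (T y)
          + cnj c * c * l2_inner x (T x)" if T: "bounded_op T" for T
      using x y bounded_op_in_l2[OF T]
      by (simp add: bounded_op_add[OF T] bounded_op_cmult[OF T] l2_cmult l2_add
          l2_inner_add_left l2_inner_add_right l2_inner_cmult_left l2_inner_cmult_right
          algebra_simps)
    have "(\<lambda>n. y n + c * x n) \<in> l2" using x y by (intro l2_add l2_cmult)
    from eq[OF this] show ?thesis
      unfolding exp[OF A] exp[OF B] by (simp add: eq x y)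
  qed
  have "l2_inner y (A x) = l2_inner y (B x)" if y: "y \<in> l2" for y
  proof -
    have "l2_inner y (A x) + l2_inner x (A y) = l2_inner y (B x) + l2_inner x (B y)"
      using pol[OF y, of 1] by simp
    moreover have "\<i> * (l2_inner y (A x) - l2_inner x (A y)) = \<i> * (l2_inner y (B x) - l2_inner x (B y))"
      using pol[OF y, of \<i>] by (simp add: algebra_simps)
    then have "l2_inner y (A x) - l2_inner x (A y) = l2_inner y (B x) - l2_inner x (B y)"
      by simp
    ultimately have "2 * l2_inner y (A x) = 2 * l2_inner y (B x)"
      by algebra
    then show ?thesis by simp
  qed
  from this[OF delta_in_l2] show ?thesis
    by (auto simp: l2_inner_delta)
qed

text \<open>Once the earlier vectors agree, so do the off-diagonal coefficients, being inner
  products with them. What remains are multiples of two unit vectors; equal norms and positive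
  factors leave no phase.\<close>

lemma Gram_Schmidt_unique:
  fixes a b :: "nat \<Rightarrow> nat \<Rightarrow> complex"
  assumes u: "\<And>i. u i \<in> l2" "\<And>i k. l2_inner (u i) (u k) = (if i = k then 1 else 0)"
    and v: "\<And>i. v i \<in> l2" "\<And>i k. l2_inner (v i) (v k) = (if i = k then 1 else 0)"
    and eq: "\<And>j. (\<lambda>n. \<Sum>i\<le>j. a i j * u i n) = (\<lambda>n. \<Sum>i\<le>j. b i j * v i n)"
    and a: "\<And>j. a j j \<in> \<real>" "\<And>j. Re (a j j) > 0"
    and b: "\<And>j. b j j \<in> \<real>" "\<And>j. Re (b j j) > 0"
  shows "u j = v j"
proof (induction j rule: less_induct)
  case (less j)
  have ab: "a i j = b i j" if "i < j" for i
  proof -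
    have "l2_inner (u i) (\<lambda>n. \<Sum>i\<le>j. a i j * u i n) = a i j"
      using that by (subst l2_inner_sum_right) (auto simp: u if_distrib cong: if_cong)
    moreover have "l2_inner (v i) (\<lambda>n. \<Sum>i\<le>j. b i j * v i n) = b i j"
      using that by (subst l2_inner_sum_right) (auto simp: v if_distrib cong: if_cong)
    ultimately show ?thesis
      using less[OF that] eq[of j] by simp
  qed
  have top: "a j j * u j n = b j j * v j n" for n
  proof -
    have "{..j} = insert j {..<j}" by auto
    moreover have "(\<Sum>i<j. a i j * u i n) = (\<Sum>i<j. b i j * v i n)"
      using ab less by (intro sum.cong) auto
    ultimately show ?thesis
      using fun_cong[OF eq[of j], of n] by simp
  qed
  have "l2_inner (\<lambda>n. a j j * u j n) (\<lambda>n. a j j * u j n) = cnj (a j j) * a j j"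
    using u by (simp add: l2_inner_cmult_left l2_inner_cmult_right l2_cmult)
  moreover have "l2_inner (\<lambda>n. b j j * v j n) (\<lambda>n. b j j * v j n) = cnj (b j j) * b j j"
    using v by (simp add: l2_inner_cmult_left l2_inner_cmult_right l2_cmult)
  ultimately have "cnj (a j j) * a j j = cnj (b j j) * b j j"
    by (simp add: top)
  moreover have ra: "a j j = complex_of_real (Re (a j j))" and rb: "b j j = complex_of_real (Re (b j j))"
    using a(1) b(1) by simp_all
  ultimately have "complex_of_real ((Re (a j j))\<^sup>2) = complex_of_real ((Re (b j j))\<^sup>2)"
    by (metis complex_cnj_complex_of_real of_real_mult power2_eq_square)
  then have "Re (a j j) = Re (b j j)"
    using a(2) b(2) by (simp only: of_real_eq_iff) (simp add: power2_eq_iff_nonneg less_imp_le)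
  then have "a j j = b j j" using ra rb by simp
  moreover have "a j j \<noteq> 0" using a(2)[of j] by auto
  ultimately show ?case using top by auto
qed

section \<open>Spectral measures and multiplication operators\<close>

context circle_measure
begin

text \<open>An inverse of \<open>coef\<close> up to null sets; the choice of representative is
  immaterial.\<close>

definition synth :: "seq \<Rightarrow> complex \<Rightarrow> complex" where
  "synth x = (SOME h. sqint \<mu> h \<and> coef h = x)"

lemma synth: "x \<in> l2 \<Longrightarrow> sqint \<mu> (synth x)" "x \<in> l2 \<Longrightarrow> coef (synth x) = x"
  using someI_ex[of "\<lambda>h. sqint \<mu> h \<and> coef h = x"] Riesz_Fischer[of x] unfolding synth_def by blast+

text \<open>Parseval turns the inner products with powers of the CMV matrix into integrals of z^n
  |f|^2.\<close>

lemma spectral_measure_exists: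
  assumes f: "sqint \<mu> f"
  shows "spectral_measure (CMV_of \<mu>) (coef f) (density \<mu> (\<lambda>z. ennreal ((cmod (f z))\<^sup>2)))"
  unfolding spectral_measure_def
proof (intro conjI allI)
  have fm [measurable]: "f \<in> borel_measurable \<mu>" using f by (simp add: sqint_def)
  show "sets (density \<mu> (\<lambda>z. ennreal ((cmod (f z))\<^sup>2))) = sets circle_borel"
    by (simp add: sets_circle)
  show "finite_measure (density \<mu> (\<lambda>z. ennreal ((cmod (f z))\<^sup>2)))"
  proof
    have "emeasure (density \<mu> (\<lambda>z. ennreal ((cmod (f z))\<^sup>2))) (space (density \<mu> (\<lambda>z. ennreal ((cmod (f z))\<^sup>2))))
        = (\<integral>\<^sup>+z. ennreal ((cmod (f z))\<^sup>2) \<partial>\<mu>)"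
      by (subst emeasure_density) (auto intro!: nn_integral_cong)
    also have "\<dots> = ennreal (\<integral>z. (cmod (f z))\<^sup>2 \<partial>\<mu>)"
      using f by (intro nn_integral_eq_integral) (auto simp: sqint_def)
    finally show "emeasure (density \<mu> (\<lambda>z. ennreal ((cmod (f z))\<^sup>2)))
        (space (density \<mu> (\<lambda>z. ennreal ((cmod (f z))\<^sup>2)))) \<noteq> \<infinity>" by simp
  qed
  fix n :: nat
  have zm: "(\<lambda>z. z ^ n) \<in> borel_measurable \<mu>"
    by (intro borel_measurable_circle_continuous[OF sets_circle] continuous_intros)
  have "(\<integral>z. z ^ n \<partial>density \<mu> (\<lambda>z. ennreal ((cmod (f z))\<^sup>2))) = ip \<mu> f (\<lambda>z. z ^ n * f z)"
    unfolding ip_def using zm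
    by (subst integral_density)
      (auto simp: scaleR_conv_of_real complex_norm_square mult_ac simp del: of_real_power
        intro!: Bochner_Integration.integral_cong)
  then show "(\<integral>z. z ^ n \<partial>density \<mu> (\<lambda>z. ennreal ((cmod (f z))\<^sup>2)))
      = l2_inner (coef f) ((CMV_of \<mu> ^^ n) (coef f))"
    by (simp add: CMV_of_power_coef f Parseval sqint_z)
qed

lemma spectral_measure_coef:
  assumes f: "sqint \<mu> f" and \<nu>: "spectral_measure (CMV_of \<mu>) (coef f) \<nu>"
  shows "\<nu> = density \<mu> (\<lambda>z. ennreal ((cmod (f z))\<^sup>2))"
  using \<nu> spectral_measure_exists[OF f] unfolding spectral_measure_def
  by (intro moments_determine_measure) simp_all

end

text \<open>Interpreted twice in the end: for the function G and for the exponent (t/2) G.\<close>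

locale circle_multiplier = circle_measure +
  fixes G :: "complex \<Rightarrow> complex" and B :: real
  assumes G_measurable [measurable]: "G \<in> borel_measurable \<mu>"
    and G_bounded: "AE z in \<mu>. cmod (G z) \<le> B"
begin

lemma sqint_G: "sqint \<mu> f \<Longrightarrow> sqint \<mu> (\<lambda>z. G z * f z)"
  by (rule sqint_mult_bounded[OF _ G_measurable G_bounded])

text \<open>The value 0 off \<open>l2\<close> matches the normalisation in
  \<open>fun_calc\<close>.\<close>

definition mult_op :: "seq \<Rightarrow> seq" where
  "mult_op x = (if x \<in> l2 then coef (\<lambda>z. G z * synth x z) else (\<lambda>_. 0))"

lemma mult_op_coef:
  assumes f: "sqint \<mu> f"
  shows "mult_op (coef f) = coef (\<lambda>z. G z * f z)"
proof -
  have x: "coef f \<in> l2" by (rule coef_in_l2[OF f])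
  have "AE z in \<mu>. synth (coef f) z = f z"
    using synth[OF x] f by (intro coef_eq_imp_AE) auto
  then have "coef (\<lambda>z. G z * synth (coef f) z) = coef (\<lambda>z. G z * f z)"
    by (intro coef_cong_AE sqint_G synth x f) auto
  then show ?thesis using x by (simp add: mult_op_def)
qed

lemma l2_obtain:
  assumes "x \<in> l2"
  obtains f where "sqint \<mu> f" "x = coef f"
  using synth[OF assms] by metis

lemma l2_norm_coef: "sqint \<mu> f \<Longrightarrow> l2_norm (coef f) = sqrt (\<integral>z. (cmod (f z))\<^sup>2 \<partial>\<mu>)"
proof -
  assume f: "sqint \<mu> f"
  have "complex_of_real ((l2_norm (coef f))\<^sup>2) = complex_of_real (\<integral>z. (cmod (f z))\<^sup>2 \<partial>\<mu>)"
    using f by (simp only: l2_norm_eq coef_in_l2 Parseval ip_self)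
  then have "(l2_norm (coef f))\<^sup>2 = (\<integral>z. (cmod (f z))\<^sup>2 \<partial>\<mu>)"
    by (simp only: of_real_eq_iff)
  moreover have "l2_norm (coef f) \<ge> 0"
    using coef_in_l2[OF f] by (simp add: l2_norm_def l2_def suminf_nonneg)
  ultimately show ?thesis by (simp add: real_sqrt_unique)
qed

lemma bounded_op_mult_op: "bounded_op mult_op"
  unfolding bounded_op_def
proof (intro conjI ballI allI)
  show "mult_op ` l2 \<subseteq> l2"
    by (auto simp: mult_op_def intro!: coef_in_l2 sqint_G synth)
next
  fix x y assume "x \<in> l2" "y \<in> l2"
  then obtain f g where fg: "sqint \<mu> f" "x = coef f" "sqint \<mu> g" "y = coef g"
    by (metis l2_obtain)
  then have "mult_op (\<lambda>n. x n + y n) = mult_op (coef (\<lambda>z. f z + g z))"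
    by (simp add: coef_add)
  also have "\<dots> = coef (\<lambda>z. G z * f z + G z * g z)"
    using fg by (simp add: mult_op_coef sqint_add distrib_left)
  also have "\<dots> = (\<lambda>n. mult_op x n + mult_op y n)"
    using fg by (simp add: coef_add sqint_G mult_op_coef)
  finally show "mult_op (\<lambda>n. x n + y n) = (\<lambda>n. mult_op x n + mult_op y n)" .
next
  fix x c assume "x \<in> l2"
  then obtain f where f: "sqint \<mu> f" "x = coef f" by (metis l2_obtain)
  then have "mult_op (\<lambda>n. c * x n) = mult_op (coef (\<lambda>z. c * f z))"
    by (simp add: coef_cmult)
  also have "\<dots> = coef (\<lambda>z. c * (G z * f z))"
    using f by (simp add: mult_op_coef sqint_cmult mult.left_commute)
  finally show "mult_op (\<lambda>n. c * x n) = (\<lambda>n. c * mult_op x n)"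
    using f by (simp add: coef_cmult mult_op_coef)
next
  have "l2_norm (mult_op x) \<le> \<bar>B\<bar> * l2_norm x" if x: "x \<in> l2" for x
  proof -
    obtain f where f: "sqint \<mu> f" "x = coef f" using x by (rule l2_obtain)
    have "(\<integral>z. (cmod (G z * f z))\<^sup>2 \<partial>\<mu>) \<le> (\<integral>z. B\<^sup>2 * (cmod (f z))\<^sup>2 \<partial>\<mu>)"
    proof (rule integral_mono_AE)
      show "AE z in \<mu>. (cmod (G z * f z))\<^sup>2 \<le> B\<^sup>2 * (cmod (f z))\<^sup>2"
        using G_bounded
        by eventually_elim (simp add: norm_mult power_mult_distrib mult_right_mono power_mono)
    qed (use f sqint_G[of f] in \<open>auto simp: sqint_def\<close>)
    then have "sqrt (\<integral>z. (cmod (G z * f z))\<^sup>2 \<partial>\<mu>) \<le> sqrt (B\<^sup>2 * (\<integral>z. (cmod (f z))\<^sup>2 \<partial>\<mu>))"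
      by simp
    then show ?thesis
      using f by (simp add: mult_op_coef l2_norm_coef sqint_G real_sqrt_mult)
  qed
  then show "\<exists>K. \<forall>x\<in>l2. l2_norm (mult_op x) \<le> K * l2_norm x" by blast
qed

lemma mult_op_quadratic_form:
  assumes x: "x \<in> l2" and \<nu>: "spectral_measure (CMV_of \<mu>) x \<nu>"
  shows "l2_inner x (mult_op x) = (\<integral>z. G z \<partial>\<nu>)"
proof -
  obtain f where f: "sqint \<mu> f" "x = coef f" using x by (rule l2_obtain)
  have fm [measurable]: "f \<in> borel_measurable \<mu>" using f by (simp add: sqint_def)
  have "l2_inner x (mult_op x) = ip \<mu> f (\<lambda>z. G z * f z)"
    using f by (simp add: mult_op_coef Parseval sqint_G)
  also have "\<dots> = (\<integral>z. G z \<partial>density \<mu> (\<lambda>z. ennreal ((cmod (f z))\<^sup>2)))"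
    unfolding ip_def
    by (subst integral_density)
      (auto simp: scaleR_conv_of_real complex_norm_square mult_ac simp del: of_real_power
        intro!: Bochner_Integration.integral_cong)
  finally show ?thesis
    using spectral_measure_coef f \<nu> by simp
qed

text \<open>Uniqueness depends on every vector having a spectral measure; for a vector without one
  the defining condition would be vacuous.\<close>

lemma fun_calc_eq: "fun_calc (CMV_of \<mu>) G = mult_op"
  unfolding fun_calc_def
proof (rule the_equality)
  show "bounded_op mult_op \<and> (\<forall>x. x \<notin> l2 \<longrightarrow> mult_op x = (\<lambda>_. 0)) \<and>
     (\<forall>x\<in>l2. \<forall>\<nu>. spectral_measure (CMV_of \<mu>) x \<nu> \<longrightarrow> l2_inner x (mult_op x) = (\<integral>z. G z \<partial>\<nu>))"
    using bounded_op_mult_op mult_op_quadratic_form by (auto simp: mult_op_def)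
next
  fix S assume S: "bounded_op S \<and> (\<forall>x. x \<notin> l2 \<longrightarrow> S x = (\<lambda>_. 0)) \<and>
     (\<forall>x\<in>l2. \<forall>\<nu>. spectral_measure (CMV_of \<mu>) x \<nu> \<longrightarrow> l2_inner x (S x) = (\<integral>z. G z \<partial>\<nu>))"
  have "l2_inner x (S x) = l2_inner x (mult_op x)" if x: "x \<in> l2" for x
  proof -
    obtain f where f: "sqint \<mu> f" "x = coef f" using x by (rule l2_obtain)
    have "spectral_measure (CMV_of \<mu>) x (density \<mu> (\<lambda>z. ennreal ((cmod (f z))\<^sup>2)))"
      unfolding f(2) by (rule spectral_measure_exists[OF f(1)])
    then show ?thesis using S x mult_op_quadratic_form by simp
  qed
  then have "S x = mult_op x" if "x \<in> l2" for x
    using S bounded_op_mult_op bounded_op_eqI_quadratic that by blast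
  then show "S = mult_op"
    using S by (intro ext) (metis mult_op_def)
qed

lemma fun_calc_coef: "sqint \<mu> f \<Longrightarrow> fun_calc (CMV_of \<mu>) G (coef f) = coef (\<lambda>z. G z * f z)"
  by (simp add: fun_calc_eq mult_op_coef)

text \<open>Coordinate k of the n-th term is the integral of \<open>F n\<close>, and the bound |X_k
  f| |B|^n / n! permits exchanging sum and integral. \<open>A\<close> is abstract because it will be
  a scalar multiple of \<open>fun_calc\<close>.\<close>

lemma op_exp_coef:
  assumes A: "\<And>f. sqint \<mu> f \<Longrightarrow> A (coef f) = coef (\<lambda>z. G z * f z)"
    and f: "sqint \<mu> f"
  shows "op_exp A (coef f) = coef (\<lambda>z. exp (G z) * f z)"
proof
  fix k
  have sq: "sqint \<mu> (\<lambda>z. G z ^ n * f z)" for n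
  proof (induction n)
    case (Suc n)
    then show ?case using sqint_G[OF Suc] by (simp add: mult.assoc)
  qed (simp add: f)
  have pow: "(A ^^ n) (coef f) = coef (\<lambda>z. G z ^ n * f z)" for n
    by (induction n) (simp_all add: A sq mult.assoc)
  define F where "F n z = cnj (X k z) * (G z ^ n * f z) / fact n" for n z
  have int: "integrable \<mu> (F n)" for n
    unfolding F_def using sqint_integrable_ip[OF sqint_X sq] by simp
  have int0: "integrable \<mu> (\<lambda>z. cmod (cnj (X k z) * f z))"
    using sqint_integrable_ip[OF sqint_X f] by (rule integrable_norm)
  have exp: "(\<lambda>n. F n z) sums (cnj (X k z) * (exp (G z) * f z))" for z
  proof -
    have "(\<lambda>n. cnj (X k z) * f z * (G z ^ n /\<^sub>R fact n)) sums (cnj (X k z) * f z * exp (G z))"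
      by (intro sums_mult exp_converges)
    moreover have "cnj (X k z) * f z * (G z ^ n /\<^sub>R fact n) = F n z" for n
      by (simp add: F_def scaleR_conv_of_real field_simps)
    ultimately show ?thesis by (simp add: mult_ac)
  qed
  have "(\<lambda>n. \<integral>z. F n z \<partial>\<mu>) sums (\<integral>z. (\<Sum>n. F n z) \<partial>\<mu>)"
  proof (rule sums_integral[OF int])
    show "AE z in \<mu>. summable (\<lambda>n. norm (F n z))"
    proof (rule AE_I2)
      fix z
      have "summable (\<lambda>n. norm (cnj (X k z) * f z) * (norm (G z) ^ n /\<^sub>R fact n))"
        by (intro summable_mult summable_exp_generic)
      then show "summable (\<lambda>n. norm (F n z))"
        by (rule summable_cong[THEN iffD1, rotated])
          (simp add: F_def norm_mult norm_divide norm_power field_simps)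
    qed
    show "summable (\<lambda>n. \<integral>z. norm (F n z) \<partial>\<mu>)"
    proof (rule summable_comparison_test')
      show "summable (\<lambda>n. (\<integral>z. cmod (cnj (X k z) * f z) \<partial>\<mu>) * (\<bar>B\<bar> ^ n /\<^sub>R fact n))"
        by (intro summable_mult summable_exp_generic)
      fix n :: nat assume "n \<ge> 0"
      have "(\<integral>z. norm (F n z) \<partial>\<mu>) \<le> (\<integral>z. cmod (cnj (X k z) * f z) * (\<bar>B\<bar> ^ n / fact n) \<partial>\<mu>)"
      proof (rule integral_mono_AE)
        show "AE z in \<mu>. norm (F n z) \<le> cmod (cnj (X k z) * f z) * (\<bar>B\<bar> ^ n / fact n)"
          using G_bounded
        proof eventually_elim
          case (elim z)
          then have "cmod (G z) ^ n \<le> \<bar>B\<bar> ^ n" by (intro power_mono) auto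
          then have "cmod (cnj (X k z) * f z) * (cmod (G z) ^ n / fact n)
              \<le> cmod (cnj (X k z) * f z) * (\<bar>B\<bar> ^ n / fact n)"
            by (intro mult_left_mono divide_right_mono) auto
          then show ?case
            by (simp add: F_def norm_mult norm_divide norm_power mult_ac)
        qed
      qed (use int int0 in \<open>auto intro!: integrable_norm\<close>)
      then show "norm (\<integral>z. norm (F n z) \<partial>\<mu>)
          \<le> (\<integral>z. cmod (cnj (X k z) * f z) \<partial>\<mu>) * (\<bar>B\<bar> ^ n /\<^sub>R fact n)"
        by (simp add: divide_inverse mult_ac)
    qed
  qed
  also have "(\<integral>z. (\<Sum>n. F n z) \<partial>\<mu>) = coef (\<lambda>z. exp (G z) * f z) k"
    using exp by (simp add: sums_iff coef_def ip_def)
  also have "(\<lambda>n. \<integral>z. F n z \<partial>\<mu>) = (\<lambda>n. (A ^^ n) (coef f) k / of_nat (fact n))"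
    unfolding pow by (simp add: F_def coef_def ip_def)
  finally show "op_exp A (coef f) k = coef (\<lambda>z. exp (G z) * f z) k"
    by (simp add: op_exp_def sums_iff)
qed

end

subsection \<open>Reweighting the measure\<close>

text \<open>Since \<open>w\<close> never vanishes, both measures have the same null sets, and
  nontriviality carries over.\<close>

locale weighted_circle = circle_measure +
  fixes w :: "complex \<Rightarrow> complex"
  assumes w_measurable [measurable]: "w \<in> borel_measurable \<mu>"
    and w_nonzero: "\<And>z. w z \<noteq> 0"
    and w_normalized: "(\<integral>\<^sup>+z. ennreal ((cmod (w z))\<^sup>2) \<partial>\<mu>) = 1"
begin

definition \<nu> :: "complex measure" where
  "\<nu> = density \<mu> (\<lambda>z. ennreal ((cmod (w z))\<^sup>2))"

lemma AE_\<nu>: "(AE z in \<nu>. P z) \<longleftrightarrow> (AE z in \<mu>. P z)"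
  unfolding \<nu>_def by (subst AE_density) (simp_all add: w_nonzero)

lemma measurable_\<nu>: "f \<in> borel_measurable \<nu> \<longleftrightarrow> f \<in> borel_measurable \<mu>"
  by (simp add: \<nu>_def)

lemma circle_measure_\<nu>: "circle_measure \<nu>"
proof -
  have "prob_space \<nu>"
  proof
    have "emeasure \<nu> (space \<nu>) = (\<integral>\<^sup>+z. ennreal ((cmod (w z))\<^sup>2) \<partial>\<mu>)"
      unfolding \<nu>_def by (subst emeasure_density) (auto intro!: nn_integral_cong)
    then show "emeasure \<nu> (space \<nu>) = 1" by (simp add: w_normalized)
  qed
  moreover have "circle_measure_axioms \<nu>"
    using nontrivial by unfold_locales
      (simp_all add: nontrivial_meas_def AE_\<nu>, simp add: \<nu>_def sets_circle)
  ultimately show ?thesis by (rule circle_measure.intro)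
qed

sublocale W: circle_measure \<nu>
  by (rule circle_measure_\<nu>)

lemma sqint_w:
  assumes f: "sqint \<nu> f"
  shows "sqint \<mu> (\<lambda>z. w z * f z)"
proof -
  have fm [measurable]: "f \<in> borel_measurable \<mu>"
    using f by (simp add: sqint_def measurable_\<nu>)
  have "integrable \<nu> (\<lambda>z. (cmod (f z))\<^sup>2)" using f by (simp add: sqint_def)
  then have "integrable \<mu> (\<lambda>z. (cmod (w z))\<^sup>2 *\<^sub>R (cmod (f z))\<^sup>2)"
    unfolding \<nu>_def by (subst (asm) integrable_density) auto
  then show ?thesis
    by (simp add: sqint_def norm_mult power_mult_distrib)
qed

lemma ip_w:
  assumes "sqint \<nu> f" "sqint \<nu> g"
  shows "ip \<nu> f g = ip \<mu> (\<lambda>z. w z * f z) (\<lambda>z. w z * g z)"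
proof -
  have [measurable]: "f \<in> borel_measurable \<mu>" "g \<in> borel_measurable \<mu>"
    using assms by (simp_all add: sqint_def measurable_\<nu>)
  have "ip \<nu> f g = (\<integral>z. (cmod (w z))\<^sup>2 *\<^sub>R (cnj (f z) * g z) \<partial>\<mu>)"
    unfolding ip_def \<nu>_def by (subst integral_density) auto
  also have "\<dots> = ip \<mu> (\<lambda>z. w z * f z) (\<lambda>z. w z * g z)"
    unfolding ip_def
    by (intro Bochner_Integration.integral_cong refl)
      (simp add: scaleR_conv_of_real complex_norm_square mult_ac del: of_real_power)
  finally show ?thesis .
qed

section \<open>The triangular change of basis and the columns of Q\<close>

definition v :: "nat \<Rightarrow> seq" where
  "v i = coef (\<lambda>z. w z * W.X i z)"

lemma v_in_l2: "v i \<in> l2"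
  unfolding v_def by (intro coef_in_l2 sqint_w W.sqint_X)

lemma v_orthonormal: "l2_inner (v i) (v k) = (if i = k then 1 else 0)"
  unfolding v_def by (simp add: Parseval sqint_w W.sqint_X W.ip_X_X flip: ip_w)

text \<open>Coordinates of \<open>X j\<close> in the CMV basis of the reweighted measure; up to a
  positive constant it plays the part of the triangular factor.\<close>

definition S :: "nat \<Rightarrow> nat \<Rightarrow> complex" where
  "S i j = ip \<nu> (W.X i) (X j)"

lemma S_lower: "j < i \<Longrightarrow> S i j = 0"
proof -
  assume "j < i"
  obtain p where p: "degree p \<le> j" "\<And>z. z \<in> sphere 0 1 \<Longrightarrow> X j z = cnj z ^ (j div 2) * poly p z"
    using X_form by blast
  then have "S i j = ip \<nu> (W.X i) (\<lambda>z. cnj z ^ (j div 2) * poly p z)"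
    unfolding S_def by (intro W.ip_cong) simp_all
  then show ?thesis using W.ip_X_lower[OF p(1) \<open>j < i\<close>] by simp
qed

text \<open>What matters is positivity. Both polynomials are monic and \<open>W.OP j\<close> is
  orthogonal to lower degrees, so their pairing is \<open>W.norm2 j\<close>. For even j the two
  arguments change places, which is harmless for a real value.\<close>

lemma S_diag: "S j j = complex_of_real (sqrt (W.norm2 j) / sqrt (norm2 j))"
proof -
  have "ip \<nu> (W.OPN j) (OPN j)
      = ip \<nu> (\<lambda>z. 1 / complex_of_real (sqrt (W.norm2 j)) * poly (W.OP j) z)
          (\<lambda>z. 1 / complex_of_real (sqrt (norm2 j)) * poly (OP j) z)"
    by (intro W.ip_cong) (simp_all add: W.OPN_def OPN_def)
  also have "\<dots> = complex_of_real (W.norm2 j / (sqrt (W.norm2 j) * sqrt (norm2 j)))"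
    unfolding ip_cmult_left ip_cmult_right
    using W.is_OP_ip[OF W.is_OP_OP, of "OP j" j] lead_coeff_OP[of j]
    by (simp add: W.ip_OP_self degree_OP)
  also have "W.norm2 j / (sqrt (W.norm2 j) * sqrt (norm2 j)) = sqrt (W.norm2 j) / sqrt (norm2 j)"
    using W.norm2_pos[of j] by (simp add: real_div_sqrt flip: divide_divide_eq_left)
  finally have OPN: "ip \<nu> (W.OPN j) (OPN j) = complex_of_real (sqrt (W.norm2 j) / sqrt (norm2 j))" .
  show ?thesis
  proof (cases "even j")
    case True
    have "S j j = ip \<nu> (OPN j) (W.OPN j)"
      unfolding S_def ip_def
    proof (intro Bochner_Integration.integral_cong refl)
      fix z assume "z \<in> space \<nu>"
      then have z: "z ^ n * cnj z ^ n = 1" for n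
        by (simp add: W.space_circle circle_power_mult_cnj)
      have "cnj (W.X j z) * X j z
          = (z ^ (j div 2) * cnj z ^ (j div 2)) * (z ^ j * cnj z ^ j) * (cnj (OPN j z) * W.OPN j z)"
        using True by (simp add: X_def W.X_def OPS_def W.OPS_def mult_ac)
      then show "cnj (W.X j z) * X j z = cnj (OPN j z) * W.OPN j z" by (simp add: z)
    qed
    also have "\<dots> = cnj (ip \<nu> (W.OPN j) (OPN j))" by (simp add: ip_cnj)
    finally show ?thesis by (simp add: OPN)
  next
    case False
    have "S j j = ip \<nu> (W.OPN j) (OPN j)"
      unfolding S_def ip_def
    proof (intro Bochner_Integration.integral_cong refl)
      fix z assume "z \<in> space \<nu>"
      then have z: "z ^ n * cnj z ^ n = 1" for n
        by (simp add: W.space_circle circle_power_mult_cnj)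
      have "cnj (W.X j z) * X j z
          = (z ^ (j div 2) * cnj z ^ (j div 2)) * (cnj (W.OPN j z) * OPN j z)"
        using False by (simp add: X_def W.X_def mult_ac)
      then show "cnj (W.X j z) * X j z = cnj (W.OPN j z) * OPN j z" by (simp add: z)
    qed
    then show ?thesis by (simp add: OPN)
  qed
qed

text \<open>By triangularity the expansion of \<open>X j\<close> in the new basis is finite. It
  holds almost everywhere for either measure, so it survives multiplication by
  \<open>w\<close>.\<close>

lemma coef_w_X: "coef (\<lambda>z. w z * X j z) = (\<lambda>n. \<Sum>i\<le>j. S i j * v i n)"
proof -
  have X: "sqint \<nu> (X j)" by (intro W.sqint_continuous continuous_X)
  \<comment> \<open>\<open>psum\<close> runs over indices below its bound, hence
    \<open>Suc j\<close>.\<close>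
  have "W.coef (X j) = W.coef (W.psum (\<lambda>i. S i j) (Suc j))"
    unfolding W.coef_psum by (auto simp: W.coef_def S_lower simp flip: S_def)
  then have "AE z in \<mu>. X j z = W.psum (\<lambda>i. S i j) (Suc j) z"
    using W.coef_eq_imp_AE[OF X W.sqint_psum] by (simp add: AE_\<nu>)
  then have "AE z in \<mu>. w z * X j z = (\<Sum>i\<le>j. S i j * (w z * W.X i z))"
    by eventually_elim
      (simp add: W.psum_def lessThan_Suc_atMost sum_distrib_left mult.left_commute)
  then have "coef (\<lambda>z. w z * X j z) = coef (\<lambda>z. \<Sum>i\<le>j. S i j * (w z * W.X i z))"
    by (intro coef_cong_AE sqint_sum sqint_cmult sqint_w X W.sqint_X)
  also have "\<dots> = (\<lambda>n. \<Sum>i\<le>j. S i j * v i n)"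
    by (subst coef_sum) (auto intro!: sqint_cmult sqint_w W.sqint_X simp: coef_cmult v_def)
  finally show ?thesis .
qed

text \<open>Both expansions of column j of QR, in \<open>Q (delta i)\<close> and in
  \<open>v i\<close>, are triangular with positive diagonal. The constant \<open>c\<close>
  compensates for the normalisation of \<open>w\<close>.\<close>

lemma unitary_factor_basis:
  assumes Q: "unitary_op Q" and R: "upper_tri_pos R" and c: "c > 0"
    and QR: "\<And>j. Q (R (delta j)) = coef (\<lambda>z. complex_of_real c * (w z * X j z))"
  shows "Q (delta j) = v j"
proof -
  have bQ: "bounded_op Q" and iQ: "\<And>x y. x \<in> l2 \<Longrightarrow> y \<in> l2 \<Longrightarrow> l2_inner (Q x) (Q y) = l2_inner x y"
    using Q by (auto simp: unitary_op_def)
  have QR_sum: "Q (R (delta j)) = (\<lambda>n. \<Sum>i\<le>j. op_entry R i j * Q (delta i) n)" for j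
  proof -
    have "R (delta j) n = (\<Sum>i\<le>j. op_entry R i j * delta i n)" for n
    proof -
      have "(\<Sum>i\<le>j. op_entry R i j * delta i n) = (\<Sum>i\<le>j. if i = n then op_entry R i j else 0)"
        by (intro sum.cong) (auto simp: delta_def)
      then show ?thesis
        using R by (auto simp: upper_tri_pos_def op_entry_def)
    qed
    then have "R (delta j) = (\<lambda>n. \<Sum>i\<le>j. op_entry R i j * delta i n)" by blast
    then show ?thesis
      using bounded_op_sum[OF _ bQ delta_in_l2, of "{..j}"] by simp
  qed
  show ?thesis
  proof (rule Gram_Schmidt_unique[where u = "\<lambda>i. Q (delta i)" and v = v
        and a = "op_entry R" and b = "\<lambda>i j. complex_of_real c * S i j"])
    show "Q (delta i) \<in> l2" for i
      using bQ delta_in_l2 bounded_op_in_l2 by blast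
    show "l2_inner (Q (delta i)) (Q (delta k)) = (if i = k then 1 else 0)" for i k
      unfolding iQ[OF delta_in_l2 delta_in_l2] l2_inner_delta by (simp add: delta_def)
    show "(\<lambda>n. \<Sum>i\<le>j. op_entry R i j * Q (delta i) n)
        = (\<lambda>n. \<Sum>i\<le>j. complex_of_real c * S i j * v i n)" for j
      unfolding QR_sum[symmetric] QR coef_cmult coef_w_X sum_distrib_left by (simp add: mult.assoc)
    show "op_entry R j j \<in> \<real>" "Re (op_entry R j j) > 0" for j
      using R by (auto simp: upper_tri_pos_def)
    show "complex_of_real c * S j j \<in> \<real>" "Re (complex_of_real c * S j j) > 0" for j
      using c norm2_pos[of j] W.norm2_pos[of j] by (simp_all add: S_diag)
  qed (simp_all add: v_in_l2 v_orthonormal)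
qed

text \<open>No infinite expansion is pushed through \<open>Q\<close>: surjectivity writes the target
  vector as \<open>Q y\<close>, and unitarity reads the coordinates of \<open>y\<close> off inner
  products with the known columns.\<close>

lemma unitary_conjugation:
  assumes Q: "unitary_op Q" and R: "upper_tri_pos R" and c: "c > 0"
    and QR: "\<And>j. Q (R (delta j)) = coef (\<lambda>z. complex_of_real c * (w z * X j z))"
    and x: "x \<in> l2"
  shows "inv_into l2 Q (CMV_of \<mu> (Q x)) = CMV_of \<nu> x"
proof -
  have bQ: "bounded_op Q" and bij: "bij_betw Q l2 l2"
    and iQ: "\<And>x y. x \<in> l2 \<Longrightarrow> y \<in> l2 \<Longrightarrow> l2_inner (Q x) (Q y) = l2_inner x y"
    using Q by (auto simp: unitary_op_def)
  have Q_coef: "Q (W.coef f) = coef (\<lambda>z. w z * f z)" if f: "sqint \<nu> f" for f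
  proof -
    have wf: "coef (\<lambda>z. w z * f z) \<in> l2" by (intro coef_in_l2 sqint_w f)
    have "coef (\<lambda>z. w z * f z) \<in> Q ` l2"
      using wf bij by (simp add: bij_betw_def)
    then obtain y where y: "y \<in> l2" "coef (\<lambda>z. w z * f z) = Q y"
      by blast
    have "y j = W.coef f j" for j
    proof -
      have "y j = l2_inner (Q (delta j)) (Q y)"
        by (simp add: iQ delta_in_l2 y l2_inner_delta)
      also have "\<dots> = ip \<mu> (\<lambda>z. w z * W.X j z) (\<lambda>z. w z * f z)"
        unfolding unitary_factor_basis[OF Q R c QR] v_def y(2)[symmetric]
        by (intro Parseval sqint_w W.sqint_X f)
      also have "\<dots> = W.coef f j"
        by (simp add: W.coef_def ip_w W.sqint_X f)
      finally show ?thesis .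
    qed
    then show ?thesis using y by (metis ext)
  qed
  obtain f where f: "sqint \<nu> f" "W.coef f = x"
    using W.Riesz_Fischer[OF x] by blast
  have zf: "sqint \<nu> (\<lambda>z. z * f z)"
    using W.sqint_z[OF f(1), of 1] by simp
  have "CMV_of \<mu> (Q x) = coef (\<lambda>z. z * (w z * f z))"
    using f by (auto simp: Q_coef CMV_of_coef sqint_w)
  also have "\<dots> = Q (W.coef (\<lambda>z. z * f z))"
    by (simp add: Q_coef[OF zf] mult.left_commute)
  also have "W.coef (\<lambda>z. z * f z) = CMV_of \<nu> x"
    using f by (auto simp: W.CMV_of_coef)
  finally have "CMV_of \<mu> (Q x) = Q (CMV_of \<nu> x)" .
  moreover have "CMV_of \<nu> x \<in> l2"
    using W.coef_in_l2[OF zf] f by (auto simp: W.CMV_of_coef)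
  ultimately show ?thesis
    using bij by (simp add: bij_betw_def inv_into_f_f)
qed

end

theorem theoremA1p2:
  fixes \<mu> :: "complex measure" and G :: "complex \<Rightarrow> real" and t :: real
    and Q R :: "seq \<Rightarrow> seq"
  assumes "prob_space \<mu>" and "sets \<mu> = sets circle_borel" and "nontrivial_meas \<mu>"
    and "G \<in> borel_measurable \<mu>" and "\<exists>B. AE z in \<mu>. \<bar>G z\<bar> \<le> B"
    and "t \<ge> 0"
    and "unitary_op Q" and "upper_tri_pos R"
    and "\<forall>x\<in>l2. op_exp (\<lambda>y. (\<lambda>k. complex_of_real (t / 2) *
            fun_calc (CMV_of \<mu>) (\<lambda>z. complex_of_real (G z)) y k)) x = Q (R x)"
  shows "\<forall>x\<in>l2. inv_into l2 Q (CMV_of \<mu> (Q x)) =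
           CMV_of (density \<mu> (\<lambda>z. ennreal (exp (t * G z) /
                     (\<integral>w. exp (t * G w) \<partial>\<mu>)))) x"
proof -
  interpret prob_space \<mu> by fact
  interpret circle_measure \<mu>
    using assms(2,3) by unfold_locales
  have Gm [measurable]: "G \<in> borel_measurable \<mu>" by fact
  obtain B where B: "AE z in \<mu>. \<bar>G z\<bar> \<le> B" using assms(5) by blast
  define Z where "Z = (\<integral>w. exp (t * G w) \<partial>\<mu>)"
  have bound: "AE z in \<mu>. \<bar>t * G z\<bar> \<le> t * B"
    using B by eventually_elim (simp add: abs_mult mult_left_mono \<open>t \<ge> 0\<close>)
  have int: "integrable \<mu> (\<lambda>z. exp (t * G z))"
    by (rule integrable_const_bound[where B = "exp (t * B)"]) (use bound in \<open>auto elim!: eventually_mono\<close>)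
  \<comment> \<open>A positive lower bound for the integrand, over total mass 1, makes
    \<open>Z\<close> positive.\<close>
  have "(\<integral>z. exp (- (t * B)) \<partial>\<mu>) \<le> Z"
    unfolding Z_def by (rule integral_mono_AE) (use bound int in \<open>auto elim!: eventually_mono\<close>)
  then have Z: "Z > 0"
    using exp_gt_zero[of "- (t * B)"] by (simp add: prob_space del: exp_gt_zero)
  define w where "w z = complex_of_real (exp (t / 2 * G z) / sqrt Z)" for z
  have wm [measurable]: "w \<in> borel_measurable \<mu>" unfolding w_def by measurable
  have w2: "(cmod (w z))\<^sup>2 = exp (t * G z) / Z" for z
    using Z by (simp add: w_def norm_divide power_divide flip: exp_double)
  interpret weighted_circle \<mu> w
  proof
    have "(\<integral>\<^sup>+z. ennreal ((cmod (w z))\<^sup>2) \<partial>\<mu>) = ennreal (\<integral>z. exp (t * G z) / Z \<partial>\<mu>)"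
      unfolding w2 using int Z by (intro nn_integral_eq_integral) auto
    also have "\<dots> = 1" using Z by (simp flip: Z_def)
    finally show "(\<integral>\<^sup>+z. ennreal ((cmod (w z))\<^sup>2) \<partial>\<mu>) = 1" .
    show "w z \<noteq> 0" for z using Z by (simp add: w_def)
  qed measurable
  interpret M: circle_multiplier \<mu> "\<lambda>z. complex_of_real (G z)" B
    using B by unfold_locales auto
  interpret E: circle_multiplier \<mu> "\<lambda>z. complex_of_real (t / 2) * complex_of_real (G z)" "t * B / 2"
  proof
    show "AE z in \<mu>. cmod (complex_of_real (t / 2) * complex_of_real (G z)) \<le> t * B / 2"
      using bound by eventually_elim (simp add: norm_mult abs_mult)
  qed measurable
  have "Q (R (delta j)) = coef (\<lambda>z. complex_of_real (sqrt Z) * (w z * X j z))" for j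
  proof -
    have "Q (R (coef (X j))) = coef (\<lambda>z. exp (complex_of_real (t / 2) * complex_of_real (G z)) * X j z)"
    proof (subst E.op_exp_coef[OF _ sqint_X, symmetric])
      show "Q (R (coef (X j))) = op_exp (\<lambda>y. (\<lambda>k. complex_of_real (t / 2) *
            fun_calc (CMV_of \<mu>) (\<lambda>z. complex_of_real (G z)) y k)) (coef (X j))"
        using assms(9) coef_in_l2[OF sqint_X] by simp
    \<comment> \<open>The premise of \<open>E.op_exp_coef\<close>: the scalar t/2 and G(C) act
      together as one multiplier.\<close>
    qed (simp only: M.fun_calc_coef coef_cmult mult.assoc)
    also have "\<dots> = coef (\<lambda>z. complex_of_real (sqrt Z) * (w z * X j z))"
      using Z by (simp add: w_def exp_of_real[symmetric])
    finally show ?thesis by (simp add: coef_basis)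
  qed
  then have "\<forall>x\<in>l2. inv_into l2 Q (CMV_of \<mu> (Q x)) = CMV_of \<nu> x"
    using unitary_conjugation[OF assms(7,8), of "sqrt Z"] Z by simp
  moreover have "\<nu> = density \<mu> (\<lambda>z. ennreal (exp (t * G z) / (\<integral>w. exp (t * G w) \<partial>\<mu>)))"
    by (simp add: \<nu>_def w2 Z_def)
  ultimately show ?thesis by simp
qed

end
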